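(* If $G$ is a finite $3$-group of nilpotency class at most $5$, then $\exp(G\wedge G)$ divides $\exp(G)$.
   Context: Conventions: $x^y=y^{-1}xy$. $\exp(G)$ denotes the exponent of $G$. $G\wedge G$ denotes the nonabelian exterior square of $G$: the group generated by symbols $g\wedge h$ ($g,h\in G$) subject to the relations $gh\wedge k=(g^h\wedge k^h)(h\wedge k)$, $g\wedge hk=(g\wedge k)(g^k\wedge h^k)$ and $g\wedge g=1$ for all $g,h,k\in G$. *)

theory Defs
  imports "HOL-Algebra.Algebra"
begin

section \<open>Groups given by generators and relations\<close>

text \<open>A word over \<open>S\<close> is a list of letters \<open>(b, s)\<close> with \<open>s \<in> S\<close>, where \<open>(True, s)\<close> stands for the
  generator \<open>s\<close> and \<open>(False, s)\<close> for its formal inverse. A pair \<open>(u, v)\<close> of words is the relation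
  \<open>u = v\<close>.\<close>

type_synonym 's word = "(bool \<times> 's) list"

definition words :: "'s set \<Rightarrow> 's word set" where
  "words S = lists (UNIV \<times> S)"

inductive pres_cong :: "'s set \<Rightarrow> ('s word \<times> 's word) set \<Rightarrow> 's word \<Rightarrow> 's word \<Rightarrow> bool"
  for S R where
  refl: "w \<in> words S \<Longrightarrow> pres_cong S R w w"
| sym: "pres_cong S R u v \<Longrightarrow> pres_cong S R v u"
| trans: "pres_cong S R u v \<Longrightarrow> pres_cong S R v w \<Longrightarrow> pres_cong S R u w"
| append: "pres_cong S R u v \<Longrightarrow> pres_cong S R u' v' \<Longrightarrow> pres_cong S R (u @ u') (v @ v')"
| cancel: "s \<in> S \<Longrightarrow> pres_cong S R [(b, s), (\<not> b, s)] []"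
| rel: "(u, v) \<in> R \<Longrightarrow> u \<in> words S \<Longrightarrow> v \<in> words S \<Longrightarrow> pres_cong S R u v"

definition pres_rel :: "'s set \<Rightarrow> ('s word \<times> 's word) set \<Rightarrow> ('s word \<times> 's word) set" where
  "pres_rel S R = {(u, v). pres_cong S R u v}"

definition presented_group :: "'s set \<Rightarrow> ('s word \<times> 's word) set \<Rightarrow> 's word set monoid" where
  "presented_group S R =
     \<lparr> carrier = words S // pres_rel S R,
       monoid.mult = (\<lambda>A B. \<Union>u\<in>A. \<Union>v\<in>B. pres_rel S R `` {u @ v}),
       one = pres_rel S R `` {[]} \<rparr>"

lemma words_simps [simp]:
  "[] \<in> words S" "(x # w \<in> words S) = (snd x \<in> S \<and> w \<in> words S)"
  "(u @ v \<in> words S) = (u \<in> words S \<and> v \<in> words S)"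
  by (auto simp: words_def mem_Times_iff)

lemma pres_cong_words: "pres_cong S R u v \<Longrightarrow> u \<in> words S \<and> v \<in> words S"
  by (induction rule: pres_cong.induct) auto

lemma equiv_pres_rel: "equiv (words S) (pres_rel S R)"
  unfolding equiv_def refl_on_def sym_def trans_def pres_rel_def
  by (auto intro: pres_cong.intros dest: pres_cong_words)

lemma pres_rel_class_eq_iff:
  assumes "u \<in> words S" "v \<in> words S"
  shows "pres_rel S R `` {u} = pres_rel S R `` {v} \<longleftrightarrow> pres_cong S R u v"
  using eq_equiv_class_iff[OF equiv_pres_rel assms] by (simp add: pres_rel_def)

lemma mult_presented_group:
  assumes "u \<in> words S" "v \<in> words S"
  shows "pres_rel S R `` {u} \<otimes>\<^bsub>presented_group S R\<^esub> pres_rel S R `` {v} = pres_rel S R `` {u @ v}"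
proof -
  let ?A = "pres_rel S R `` {u}" and ?B = "pres_rel S R `` {v}" and ?C = "pres_rel S R `` {u @ v}"
  have *: "pres_rel S R `` {u' @ v'} = ?C" if "u' \<in> ?A" "v' \<in> ?B" for u' v'
  proof -
    have "pres_cong S R u u'" "pres_cong S R v v'"
      using that by (simp_all add: pres_rel_def)
    from pres_cong.sym[OF pres_cong.append[OF this]] show ?thesis
      using pres_rel_class_eq_iff[of "u' @ v'" S "u @ v" R] pres_cong_words[of S R "u' @ v'" "u @ v"]
      by simp
  qed
  have "u \<in> ?A" "v \<in> ?B"
    using assms by (simp_all add: pres_rel_def pres_cong.refl)
  with * have "(\<Union>u'\<in>?A. \<Union>v'\<in>?B. pres_rel S R `` {u' @ v'}) = ?C" by blast
  then show ?thesis
    by (simp add: presented_group_def)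
qed

lemma carrier_presented_group:
  "carrier (presented_group S R) = (\<lambda>w. pres_rel S R `` {w}) ` words S"
  by (auto simp: presented_group_def quotient_def)

lemma one_presented_group: "\<one>\<^bsub>presented_group S R\<^esub> = pres_rel S R `` {[]}"
  by (simp add: presented_group_def)

lemma pres_cong_inverse:
  "w \<in> words S \<Longrightarrow> pres_cong S R (map (\<lambda>(b, s). (\<not> b, s)) (rev w) @ w) []"
proof (induction w)
  case Nil
  show ?case by (simp add: pres_cong.refl)
next
  case (Cons x w)
  obtain b s where x: "x = (b, s)" by force
  let ?i = "map (\<lambda>(b, s). (\<not> b, s)) (rev w)"
  have w: "w \<in> words S" and s: "s \<in> S" using Cons.prems x by auto
  have i: "?i \<in> words S" using pres_cong_words[OF Cons.IH[OF w]] by simp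
  have "pres_cong S R ([(\<not> b, s), (b, s)] @ w) ([] @ w)"
    using pres_cong.append[OF pres_cong.cancel[OF s, of R "\<not> b"] pres_cong.refl[OF w]] by simp
  then have "pres_cong S R (?i @ [(\<not> b, s), (b, s)] @ w) (?i @ w)"
    using pres_cong.append[OF pres_cong.refl[OF i]] by fastforce
  from pres_cong.trans[OF this Cons.IH[OF w]] show ?case by (simp add: x)
qed

theorem group_presented_group: "group (presented_group S R)"
proof (rule groupI)
  fix x assume "x \<in> carrier (presented_group S R)"
  then obtain w where w: "w \<in> words S" "x = pres_rel S R `` {w}"
    by (auto simp: carrier_presented_group)
  let ?i = "map (\<lambda>(b, s). (\<not> b, s)) (rev w)"
  have i: "?i \<in> words S" using pres_cong_words[OF pres_cong_inverse[OF w(1)]] by simp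
  have "pres_rel S R `` {?i} \<otimes>\<^bsub>presented_group S R\<^esub> x = \<one>\<^bsub>presented_group S R\<^esub>"
    using w i pres_cong_inverse[OF w(1)]
    by (simp add: mult_presented_group one_presented_group pres_rel_class_eq_iff)
  then show "\<exists>y\<in>carrier (presented_group S R). y \<otimes>\<^bsub>presented_group S R\<^esub> x = \<one>\<^bsub>presented_group S R\<^esub>"
    using i by (auto simp: carrier_presented_group)
next
  show "\<one>\<^bsub>presented_group S R\<^esub> \<in> carrier (presented_group S R)"
    by (simp add: carrier_presented_group one_presented_group)
next
  fix x y assume "x \<in> carrier (presented_group S R)" "y \<in> carrier (presented_group S R)"
  then obtain u v where "u \<in> words S" "v \<in> words S"
      "x = pres_rel S R `` {u}" "y = pres_rel S R `` {v}"
    unfolding carrier_presented_group by blast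
  then show "x \<otimes>\<^bsub>presented_group S R\<^esub> y \<in> carrier (presented_group S R)"
    by (simp only: mult_presented_group carrier_presented_group) (rule imageI, simp)
next
  fix x y z
  assume "x \<in> carrier (presented_group S R)" "y \<in> carrier (presented_group S R)"
    "z \<in> carrier (presented_group S R)"
  then obtain u v w where "u \<in> words S" "v \<in> words S" "w \<in> words S"
      "x = pres_rel S R `` {u}" "y = pres_rel S R `` {v}" "z = pres_rel S R `` {w}"
    unfolding carrier_presented_group by blast
  then show "x \<otimes>\<^bsub>presented_group S R\<^esub> y \<otimes>\<^bsub>presented_group S R\<^esub> z =
      x \<otimes>\<^bsub>presented_group S R\<^esub> (y \<otimes>\<^bsub>presented_group S R\<^esub> z)"
    by (simp add: mult_presented_group)
next
  fix x assume "x \<in> carrier (presented_group S R)"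
  then obtain u where "u \<in> words S" "x = pres_rel S R `` {u}"
    unfolding carrier_presented_group by blast
  then show "\<one>\<^bsub>presented_group S R\<^esub> \<otimes>\<^bsub>presented_group S R\<^esub> x = x"
    by (simp add: one_presented_group mult_presented_group)
qed

definition eval_letter :: "('b, 'm) monoid_scheme \<Rightarrow> ('s \<Rightarrow> 'b) \<Rightarrow> bool \<times> 's \<Rightarrow> 'b" where
  "eval_letter H f = (\<lambda>(b, s). if b then f s else inv\<^bsub>H\<^esub> f s)"

definition eval_word :: "('b, 'm) monoid_scheme \<Rightarrow> ('s \<Rightarrow> 'b) \<Rightarrow> 's word \<Rightarrow> 'b" where
  "eval_word H f w = foldr (\<lambda>x y. eval_letter H f x \<otimes>\<^bsub>H\<^esub> y) w \<one>\<^bsub>H\<^esub>"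

text \<open>Universal property: an assignment of the generators in a group \<open>H\<close> that respects the relations
  extends to a homomorphism.\<close>

theorem presented_group_hom:
  assumes H: "group H" and f: "\<And>s. s \<in> S \<Longrightarrow> f s \<in> carrier H"
    and R: "\<And>u v. (u, v) \<in> R \<Longrightarrow> u \<in> words S \<Longrightarrow> v \<in> words S \<Longrightarrow> eval_word H f u = eval_word H f v"
  obtains \<phi> where "\<phi> \<in> hom (presented_group S R) H"
    "\<And>w. w \<in> words S \<Longrightarrow> \<phi> (pres_rel S R `` {w}) = eval_word H f w"
proof -
  interpret H: group H by fact
  have letter: "eval_letter H f x \<in> carrier H" if "snd x \<in> S" for x
    using that f by (cases x) (auto simp: eval_letter_def)
  have cl: "eval_word H f w \<in> carrier H" if "w \<in> words S" for w
    using that by (induction w) (auto simp: eval_word_def letter)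
  have app: "eval_word H f (u @ v) = eval_word H f u \<otimes>\<^bsub>H\<^esub> eval_word H f v"
    if "u \<in> words S" "v \<in> words S" for u v
    using that(1)
  proof (induction u)
    case Nil
    then show ?case using cl[OF that(2)] by (simp add: eval_word_def)
  next
    case (Cons x u)
    then show ?case using cl[of u] cl[OF that(2)] letter[of x]
      by (simp add: eval_word_def H.m_assoc)
  qed
  have cong: "eval_word H f u = eval_word H f v" if "pres_cong S R u v" for u v
    using that
  proof (induction rule: pres_cong.induct)
    case (append u v u' v')
    then show ?case by (metis app pres_cong_words)
  next
    case (cancel s b)
    then show ?case using f by (auto simp: eval_word_def eval_letter_def)
  qed (auto intro: R)
  define \<phi> where "\<phi> A = eval_word H f (SOME w. w \<in> A)" for A
  have val: "\<phi> (pres_rel S R `` {w}) = eval_word H f w" if "w \<in> words S" for w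
  proof -
    have "w \<in> pres_rel S R `` {w}" using that by (auto simp: pres_rel_def intro: pres_cong.refl)
    then have "(SOME v. v \<in> pres_rel S R `` {w}) \<in> pres_rel S R `` {w}" by (rule someI)
    then show ?thesis unfolding \<phi>_def using cong by (auto simp: pres_rel_def)
  qed
  have "\<phi> \<in> hom (presented_group S R) H"
    by (rule homI) (auto simp: carrier_presented_group mult_presented_group val cl app)
  with val that show ?thesis by blast
qed

section \<open>The nonabelian exterior square\<close>

definition conjugate :: "('a, 'm) monoid_scheme \<Rightarrow> 'a \<Rightarrow> 'a \<Rightarrow> 'a" where
  "conjugate G x y = inv\<^bsub>G\<^esub> y \<otimes>\<^bsub>G\<^esub> x \<otimes>\<^bsub>G\<^esub> y"

text \<open>The symbol \<open>g \<and> h\<close> is the generator \<open>(g, h)\<close>.\<close>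

definition wedge_relations :: "('a, 'm) monoid_scheme \<Rightarrow> (('a \<times> 'a) word \<times> ('a \<times> 'a) word) set" where
  "wedge_relations G =
     {([(True, (g \<otimes>\<^bsub>G\<^esub> h, k))], [(True, (conjugate G g h, conjugate G k h)), (True, (h, k))])
        | g h k. g \<in> carrier G \<and> h \<in> carrier G \<and> k \<in> carrier G}
   \<union> {([(True, (g, h \<otimes>\<^bsub>G\<^esub> k))], [(True, (g, k)), (True, (conjugate G g k, conjugate G h k))])
        | g h k. g \<in> carrier G \<and> h \<in> carrier G \<and> k \<in> carrier G}
   \<union> {([(True, (g, g))], []) | g. g \<in> carrier G}"

definition exterior_square :: "('a, 'm) monoid_scheme \<Rightarrow> ('a \<times> 'a) word set monoid" where
  "exterior_square G = presented_group (carrier G \<times> carrier G) (wedge_relations G)"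

section \<open>Exponent and nilpotency class\<close>

text \<open>The value is \<open>0\<close> if no positive power annihilates the group.\<close>

definition group_exponent :: "('a, 'm) monoid_scheme \<Rightarrow> nat" where
  "group_exponent G =
     (if \<exists>n::nat. n > 0 \<and> (\<forall>x\<in>carrier G. x [^]\<^bsub>G\<^esub> n = \<one>\<^bsub>G\<^esub>)
      then LEAST n::nat. n > 0 \<and> (\<forall>x\<in>carrier G. x [^]\<^bsub>G\<^esub> n = \<one>\<^bsub>G\<^esub>) else 0)"

definition commutator :: "('a, 'm) monoid_scheme \<Rightarrow> 'a \<Rightarrow> 'a \<Rightarrow> 'a" where
  "commutator G x y = inv\<^bsub>G\<^esub> x \<otimes>\<^bsub>G\<^esub> inv\<^bsub>G\<^esub> y \<otimes>\<^bsub>G\<^esub> x \<otimes>\<^bsub>G\<^esub> y"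

text \<open>Indexing starts at \<open>0\<close>: \<open>lower_central G i\<close> is the term usually written \<open>\<gamma>\<close> with index \<open>i + 1\<close>,
  so the class is the least \<open>c\<close> with \<open>lower_central G c\<close> trivial.\<close>

primrec lower_central :: "('a, 'm) monoid_scheme \<Rightarrow> nat \<Rightarrow> 'a set" where
  "lower_central G 0 = carrier G"
| "lower_central G (Suc i) =
     generate G {commutator G x y | x y. x \<in> lower_central G i \<and> y \<in> carrier G}"

definition nilpotent_group :: "('a, 'm) monoid_scheme \<Rightarrow> bool" where
  "nilpotent_group G \<longleftrightarrow> group G \<and> (\<exists>c. lower_central G c = {\<one>\<^bsub>G\<^esub>})"

text \<open>Meaningful only for nilpotent groups.\<close>

definition nilpotency_class :: "('a, 'm) monoid_scheme \<Rightarrow> nat" where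
  "nilpotency_class G = (LEAST c. lower_central G c = {\<one>\<^bsub>G\<^esub>})"

end

theory Submission
  imports Defs
begin

text \<open>Let \<open>e = 3 q\<close> be the exponent of \<open>G\<close>; the case \<open>e = 1\<close> is trivial. The Hall-Petrescu formula for \<open>(x y)\<^sup>e\<close> in class at most
  \<open>5\<close> has binomial exponents divisible by \<open>e\<close>, except for the weight 3 term, where the exponent is
  \<open>q\<close> up to a factor prime to 3. So the \<open>q\<close>-th power of the weight 3 term vanishes in \<open>G\<close>. Modulo the normal
  subgroup of those \<open>a \<in> \<gamma>\<^sub>3\<close> with \<open>a\<^sup>q = 1\<close>, this becomes a law that forces the quotient to be 2-Engel,
  hence of class at most 3 by Levi's argument. Therefore \<open>[y, x, x]\<close> and \<open>\<gamma>\<^sub>4(G)\<close> are killed by \<open>q\<close>.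

  The exterior square \<open>M\<close> is a crossed module over \<open>G\<close>, and \<open>S = G \<ltimes> M\<close> again has class at most
  \<open>5\<close>. There \<open>t\<^sup>n = 1\<close> implies \<open>(t (t \<and> k))\<^sup>n = 1\<close>, so the Hall-Petrescu formula in \<open>S\<close> transfers the
  torsion of \<open>\<gamma>\<^sub>i(G)\<close> to \<open>\<gamma>\<^sub>i(S) \<inter> M\<close>, for \<open>i\<close> descending from \<open>4\<close> to \<open>1\<close>.\<close>

section \<open>Commutators and the lower central series\<close>

text \<open>Of the indices 2, 3, 4, 5 only 3 is not coprime to \<open>e\<close>, so a single
  correction term, of weight 3, resists; it has to be killed by \<open>q\<close> instead of
  \<open>e\<close>, and this is the reason for the Engel analysis of \<open>G\<close>. The exterior
  square alone gives no hold on the power of a wedge. Inside \<open>S\<close>, the left product rule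
  makes t -> t (t \<and> k) a homomorphism from \<open>G\<close>, so the power \<open>e\<close> of t
  (t \<and> k) is trivial, and its Hall-Petrescu expansion compares (t \<and> k)^e with correction
  terms only. For t in \<open>G\<close> their weight 3 part is, up to conjugation and deeper
  factors, [t, k, t] \<and> t, controlled by the order of [t, k, t] in \<open>G\<close>. In
  \<open>S\<close> the commutator of m in \<open>M\<close> with g in \<open>G\<close> is the wedge
  of the boundary of m with g; hence \<open>\<gamma>\<^sub>i(S)\<close> meets \<open>M\<close> in
  the subgroup generated by the wedges of \<open>\<gamma>\<^sub>i(G)\<close> with \<open>G\<close>.
  Two elements of \<open>M\<close> commute one step better than their depths suggest, because
  \<open>M\<close> acts on itself through boundaries, which lie in
  \<open>\<gamma>\<^sub>2(G)\<close>. This makes the deep layers commutative and lets torsion pass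
  from wedges to their products.\<close>

declare lower_central.simps(2) [simp del]

context group
begin

abbreviation cj :: "'a \<Rightarrow> 'a \<Rightarrow> 'a" where "cj x y \<equiv> conjugate G x y"
abbreviation cm :: "'a \<Rightarrow> 'a \<Rightarrow> 'a" where "cm x y \<equiv> commutator G x y"

lemma inv_cancel_left:
  "x \<in> carrier G \<Longrightarrow> y \<in> carrier G \<Longrightarrow> inv x \<otimes> (x \<otimes> y) = y"
  "x \<in> carrier G \<Longrightarrow> y \<in> carrier G \<Longrightarrow> x \<otimes> (inv x \<otimes> y) = y"
  by (simp_all flip: m_assoc)

lemmas word_simps = m_assoc inv_mult_group inv_cancel_left conjugate_def commutator_def

lemma conjugate_closed [simp, intro]: "x \<in> carrier G \<Longrightarrow> y \<in> carrier G \<Longrightarrow> cj x y \<in> carrier G"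
  by (simp add: conjugate_def)

lemma commutator_closed [simp, intro]: "x \<in> carrier G \<Longrightarrow> y \<in> carrier G \<Longrightarrow> cm x y \<in> carrier G"
  by (simp add: commutator_def)

lemma conjugate_mult:
  "x \<in> carrier G \<Longrightarrow> y \<in> carrier G \<Longrightarrow> z \<in> carrier G \<Longrightarrow> cj (x \<otimes> y) z = cj x z \<otimes> cj y z"
  by (simp add: word_simps)

lemma conjugate_conjugate:
  "x \<in> carrier G \<Longrightarrow> y \<in> carrier G \<Longrightarrow> z \<in> carrier G \<Longrightarrow> cj (cj x y) z = cj x (y \<otimes> z)"
  by (simp add: word_simps)

lemma conjugate_one [simp]: "x \<in> carrier G \<Longrightarrow> cj x \<one> = x" "x \<in> carrier G \<Longrightarrow> cj \<one> x = \<one>"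
  by (simp_all add: word_simps)

lemma conjugate_pow:
  "x \<in> carrier G \<Longrightarrow> y \<in> carrier G \<Longrightarrow> cj (x [^] n) y = cj x y [^] (n::nat)"
  by (induction n) (simp_all add: conjugate_mult)

lemma conjugate_eq: "x \<in> carrier G \<Longrightarrow> y \<in> carrier G \<Longrightarrow> cj x y = x \<otimes> cm x y"
  by (simp add: word_simps)

lemma commutator_eq_one_iff:
  "x \<in> carrier G \<Longrightarrow> y \<in> carrier G \<Longrightarrow> cm x y = \<one> \<longleftrightarrow> x \<otimes> y = y \<otimes> x"
proof -
  assume xy: "x \<in> carrier G" "y \<in> carrier G"
  have "cm x y = inv (y \<otimes> x) \<otimes> (x \<otimes> y)" using xy by (simp add: word_simps)
  then show ?thesis using xy
    by (metis inv_closed inv_equality inv_inv m_closed l_inv)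
qed

lemma commutator_one [simp]: "x \<in> carrier G \<Longrightarrow> cm x \<one> = \<one>" "x \<in> carrier G \<Longrightarrow> cm \<one> x = \<one>"
  by (simp_all add: word_simps)

lemma inv_commutator: "x \<in> carrier G \<Longrightarrow> y \<in> carrier G \<Longrightarrow> inv (cm x y) = cm y x"
  by (simp add: word_simps)

lemma commutator_mult_left:
  "x \<in> carrier G \<Longrightarrow> y \<in> carrier G \<Longrightarrow> z \<in> carrier G \<Longrightarrow> cm (x \<otimes> y) z = cj (cm x z) y \<otimes> cm y z"
  by (simp add: word_simps)

lemma commutator_mult_right:
  "x \<in> carrier G \<Longrightarrow> y \<in> carrier G \<Longrightarrow> z \<in> carrier G \<Longrightarrow> cm x (y \<otimes> z) = cm x z \<otimes> cj (cm x y) z"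
  by (simp add: word_simps)

lemma commutator_inv_left:
  "x \<in> carrier G \<Longrightarrow> y \<in> carrier G \<Longrightarrow> cm (inv x) y = cj (inv (cm x y)) (inv x)"
  by (simp add: word_simps)

lemma conjugate_commutator:
  "x \<in> carrier G \<Longrightarrow> y \<in> carrier G \<Longrightarrow> z \<in> carrier G \<Longrightarrow> cj (cm x y) z = cm (cj x z) (cj y z)"
  by (simp add: word_simps)

lemma Hall_Witt:
  assumes "x \<in> carrier G" "y \<in> carrier G" "z \<in> carrier G"
  shows "cj (cm (cm x (inv y)) z) y \<otimes> cj (cm (cm y (inv z)) x) z \<otimes> cj (cm (cm z (inv x)) y) x = \<one>"
  using assms by (simp add: word_simps)

lemma pow_add: "x \<in> carrier G \<Longrightarrow> x [^] (n + m :: nat) = x [^] n \<otimes> x [^] m"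
  by (simp add: nat_pow_mult)

lemma normal_conjugate: "N \<lhd> G \<Longrightarrow> x \<in> N \<Longrightarrow> y \<in> carrier G \<Longrightarrow> cj x y \<in> N"
  by (simp add: conjugate_def normal.inv_op_closed1)

lemma normal_conjugate_iff:
  assumes "N \<lhd> G" "x \<in> carrier G" "y \<in> carrier G"
  shows "cj x y \<in> N \<longleftrightarrow> x \<in> N"
  using normal_conjugate[OF assms(1), of x y] normal_conjugate[OF assms(1), of "cj x y" "inv y"] assms
  by (auto simp: conjugate_conjugate)

lemma normalI_conjugate:
  assumes "subgroup N G" "\<And>x y. x \<in> N \<Longrightarrow> y \<in> carrier G \<Longrightarrow> cj x y \<in> N"
  shows "N \<lhd> G"
proof (rule normal_invI[OF assms(1)])
  fix g h assume "g \<in> carrier G" "h \<in> N"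
  then show "g \<otimes> h \<otimes> inv g \<in> N"
    using assms(2)[of h "inv g"] by (simp add: conjugate_def)
qed

lemma normal_commutator:
  assumes "N \<lhd> G" "x \<in> N" "y \<in> carrier G"
  shows "cm x y \<in> N" "cm y x \<in> N"
proof -
  have N: "subgroup N G" using assms(1) by (rule normal_imp_subgroup)
  have x: "x \<in> carrier G" using N assms(2) by (rule subgroup.mem_carrier)
  have "cm x y = inv x \<otimes> cj x y" using x assms by (simp add: word_simps)
  then show "cm x y \<in> N"
    using N normal_conjugate[OF assms] assms(2) by (simp add: subgroup.m_closed subgroup.m_inv_closed)
  then show "cm y x \<in> N"
    using N inv_commutator[OF x assms(3)] by (metis subgroup.m_inv_closed)
qed

lemma normal_commutator_swap:
  assumes "subgroup N G" "x \<in> carrier G" "y \<in> carrier G"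
  shows "cm x y \<in> N \<longleftrightarrow> cm y x \<in> N"
  using assms by (metis inv_commutator subgroup.m_inv_closed)

lemma subgroup_mult_mem_right:
  assumes "subgroup N G" "x \<in> N" "y \<in> carrier G"
  shows "y \<otimes> x \<in> N \<longleftrightarrow> y \<in> N"
proof
  have x: "x \<in> carrier G" using assms(1,2) by (rule subgroup.mem_carrier)
  assume "y \<otimes> x \<in> N"
  then have "(y \<otimes> x) \<otimes> inv x \<in> N"
    using assms by (simp add: subgroup.m_closed subgroup.m_inv_closed)
  then show "y \<in> N" using x assms by (simp add: word_simps)
qed (use assms in \<open>simp add: subgroup.m_closed\<close>)

end

text \<open>For normal \<open>N\<close> this is the preimage of a centralizer in the quotient by
  \<open>N\<close>. It is a subgroup, which reduces commutator conditions to generators. With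
  \<open>B\<close> the whole group it is the preimage of the center, and iterating it expresses a
  class bound modulo \<open>N\<close> inside \<open>G\<close>.\<close>

definition centralizer_mod :: "('a, 'm) monoid_scheme \<Rightarrow> 'a set \<Rightarrow> 'a set \<Rightarrow> 'a set" where
  "centralizer_mod G N B = {a \<in> carrier G. \<forall>b\<in>B. commutator G a b \<in> N}"

context group
begin

lemma subgroup_centralizer_mod:
  assumes N: "N \<lhd> G" and B: "B \<subseteq> carrier G"
  shows "subgroup (centralizer_mod G N B) G"
proof -
  have N': "subgroup N G" using N by (rule normal_imp_subgroup)
  show ?thesis
  proof (rule subgroupI)
    have "\<one> \<in> centralizer_mod G N B"
      using B subgroup.one_closed[OF N'] by (auto simp: centralizer_mod_def subset_iff)
    then show "centralizer_mod G N B \<noteq> {}" by blast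
  next
    fix a assume a: "a \<in> centralizer_mod G N B"
    then have "cm (inv a) b \<in> N" if "b \<in> B" for b
      using that B N N' subgroup.m_inv_closed[OF N']
      by (auto simp: centralizer_mod_def commutator_inv_left subset_iff intro!: normal_conjugate)
    with a show "inv a \<in> centralizer_mod G N B" by (simp add: centralizer_mod_def)
  next
    fix a a' assume a: "a \<in> centralizer_mod G N B" "a' \<in> centralizer_mod G N B"
    then have "cm (a \<otimes> a') b \<in> N" if "b \<in> B" for b
      using that B
      by (auto simp: centralizer_mod_def commutator_mult_left subset_iff
          intro!: subgroup.m_closed[OF N'] normal_conjugate[OF N])
    with a show "a \<otimes> a' \<in> centralizer_mod G N B" by (simp add: centralizer_mod_def)
  qed (auto simp: centralizer_mod_def)
qed

lemma normal_centralizer_mod: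
  assumes N: "N \<lhd> G"
  shows "centralizer_mod G N (carrier G) \<lhd> G"
proof (rule normalI_conjugate)
  show "subgroup (centralizer_mod G N (carrier G)) G"
    using N by (rule subgroup_centralizer_mod) simp
next
  fix x y assume x: "x \<in> centralizer_mod G N (carrier G)" and y: "y \<in> carrier G"
  have "cm (cj x y) b \<in> N" if b: "b \<in> carrier G" for b
  proof -
    have "cm (cj x y) b = cj (cm x (cj b (inv y))) y"
      using x y b by (simp add: conjugate_commutator conjugate_conjugate centralizer_mod_def)
    then show ?thesis using x y b N by (auto simp: centralizer_mod_def intro!: normal_conjugate)
  qed
  then show "cj x y \<in> centralizer_mod G N (carrier G)"
    using x y by (simp add: centralizer_mod_def)
qed

lemma commutator_generate_left:
  assumes "N \<lhd> G" "Y \<subseteq> carrier G" "B \<subseteq> carrier G" "\<And>x b. x \<in> Y \<Longrightarrow> b \<in> B \<Longrightarrow> cm x b \<in> N"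
    and "x \<in> generate G Y" "b \<in> B"
  shows "cm x b \<in> N"
proof -
  have "generate G Y \<subseteq> centralizer_mod G N B"
    using assms by (intro generate_subgroup_incl subgroup_centralizer_mod) (auto simp: centralizer_mod_def)
  then show ?thesis using assms by (auto simp: centralizer_mod_def)
qed

lemma commutator_generate_right:
  assumes "N \<lhd> G" "Y \<subseteq> carrier G" "B \<subseteq> carrier G" "\<And>x b. x \<in> Y \<Longrightarrow> b \<in> B \<Longrightarrow> cm b x \<in> N"
    and "x \<in> generate G Y" "b \<in> B"
  shows "cm b x \<in> N"
proof -
  note swap = normal_commutator_swap[OF normal_imp_subgroup[OF assms(1)]]
  have "cm y c \<in> N" if "y \<in> Y" "c \<in> B" for y c
    using that assms(2-4) swap[of y c] by auto
  from commutator_generate_left[OF assms(1-3) this assms(5,6)] have "cm x b \<in> N" .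
  moreover have "x \<in> carrier G" "b \<in> carrier G"
    using assms generate_in_carrier by auto
  ultimately show ?thesis by (simp add: swap)
qed

section \<open>The lower central series and commutators of its terms\<close>

lemma normal_lower_central: "lower_central G i \<lhd> G"
proof (induction i)
  case 0
  show ?case by (simp add: normal_self)
next
  case (Suc i)
  have sub: "lower_central G i \<subseteq> carrier G"
    using normal_imp_subgroup[OF Suc] by (rule subgroup.subset)
  show ?case unfolding lower_central.simps
  proof (rule normal_generateI)
    fix h g assume "h \<in> {cm x y |x y. x \<in> lower_central G i \<and> y \<in> carrier G}" and g: "g \<in> carrier G"
    then obtain x y where x: "x \<in> lower_central G i" "y \<in> carrier G" "h = cm x y" by blast
    have "g \<otimes> h \<otimes> inv g = cm (cj x (inv g)) (cj y (inv g))"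
      using x g sub by (subst conjugate_commutator[symmetric]) (auto simp: conjugate_def)
    moreover have "cj x (inv g) \<in> lower_central G i" "cj y (inv g) \<in> carrier G"
      using x g normal_conjugate[OF Suc] by auto
    ultimately show "g \<otimes> h \<otimes> inv g \<in> {cm x y |x y. x \<in> lower_central G i \<and> y \<in> carrier G}"
      by blast
  qed (use sub in auto)
qed

lemmas subgroup_lower_central = normal_imp_subgroup[OF normal_lower_central]

lemma lower_central_carrier: "x \<in> lower_central G i \<Longrightarrow> x \<in> carrier G"
  using subgroup_lower_central by (rule subgroup.mem_carrier)

lemma commutator_lower_central:
  "x \<in> lower_central G i \<Longrightarrow> y \<in> carrier G \<Longrightarrow> cm x y \<in> lower_central G (Suc i)"
  by (auto simp: lower_central.simps intro: generate.incl)

lemma lower_central_Suc_subset: "lower_central G (Suc i) \<subseteq> lower_central G i"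
  unfolding lower_central.simps
  using normal_commutator(1)[OF normal_lower_central]
  by (intro generate_subgroup_incl subgroup_lower_central) auto

lemma lower_central_antimono: "i \<le> j \<Longrightarrow> lower_central G j \<subseteq> lower_central G i"
  using lower_central_Suc_subset by (rule lift_Suc_antimono_le)

lemma lower_central_SucI:
  assumes "N \<lhd> G" "\<And>x y. x \<in> lower_central G i \<Longrightarrow> y \<in> carrier G \<Longrightarrow> cm x y \<in> N"
  shows "lower_central G (Suc i) \<subseteq> N"
  unfolding lower_central.simps using assms
  by (intro generate_subgroup_incl normal_imp_subgroup) auto

text \<open>Three subgroups argument: \<open>y\<close> may be taken as a generator [p, g] with
  \<open>p\<close> one level higher. Hall-Witt trades [p, g, a] for two commutators in which
  \<open>p\<close> is paired with an element built from \<open>a\<close>; the induction hypothesis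
  covers both, once at level \<open>Suc i\<close>, hence the arbitrary \<open>i\<close>. The
  \<open>Suc\<close> in the conclusion comes from indexing at 0.\<close>

lemma commutator_lower_central_lower_central:
  assumes "x \<in> lower_central G i" "y \<in> lower_central G j"
  shows "cm x y \<in> lower_central G (Suc (i + j))"
  using assms
proof (induction j arbitrary: i x y)
  case 0
  then show ?case by (simp add: commutator_lower_central)
next
  case (Suc j)
  let ?N = "lower_central G (Suc (Suc (i + j)))"
  have N: "?N \<lhd> G" and N': "subgroup ?N G" by (rule normal_lower_central subgroup_lower_central)+
  have *: "cm (cm p g) a \<in> ?N" if p: "p \<in> lower_central G j" and g: "g \<in> carrier G"
    and a: "a \<in> lower_central G i" for p g a
  proof -
    have pa: "p \<in> carrier G" "a \<in> carrier G" using p a lower_central_carrier by auto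
    have 1: "cm (cm (inv g) (inv a)) p \<in> ?N"
    proof -
      have "cm (inv g) (inv a) \<in> lower_central G (Suc i)"
        using a g pa commutator_lower_central[of "inv a" i "inv g"] subgroup.m_inv_closed[OF subgroup_lower_central]
          normal_commutator_swap[OF subgroup_lower_central, of "inv g" "inv a" "Suc i"] by auto
      from Suc.IH[OF this p] show ?thesis by simp
    qed
    have 2: "cm (cm a (inv p)) (inv g) \<in> ?N"
    proof -
      have "cm a (inv p) \<in> lower_central G (Suc (i + j))"
        using Suc.IH[OF a] p subgroup.m_inv_closed[OF subgroup_lower_central] by auto
      from commutator_lower_central[OF this, of "inv g"] g show ?thesis by simp
    qed
    have "cj (cm (cm p g) a) (inv g) \<otimes> cj (cm (cm (inv g) (inv a)) p) a \<otimes> cj (cm (cm a (inv p)) (inv g)) p \<in> ?N"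
      using Hall_Witt[of p "inv g" a] g pa subgroup.one_closed[OF N'] by simp
    then have "cj (cm (cm p g) a) (inv g) \<in> ?N"
      using 1 2 pa g normal_conjugate[OF N] by (simp add: subgroup_mult_mem_right[OF N'])
    then show ?thesis using pa g by (simp add: normal_conjugate_iff[OF N])
  qed
  have "cm x y \<in> ?N"
  proof (rule commutator_generate_right[OF N, of _ "lower_central G i"])
    show "y \<in> generate G {cm p g |p g. p \<in> lower_central G j \<and> g \<in> carrier G}"
      using Suc.prems(2) by (simp add: lower_central.simps)
  next
    fix u b assume "u \<in> {cm p g |p g. p \<in> lower_central G j \<and> g \<in> carrier G}" "b \<in> lower_central G i"
    then show "cm b u \<in> ?N"
      using * normal_commutator_swap[OF N'] lower_central_carrier by auto
  qed (use lower_central_carrier Suc.prems in auto)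
  then show ?case by simp
qed

end

section \<open>Polynomial sequences and the Hall-Petrescu formula\<close>

text \<open>Degree 0 is an arbitrary subgroup, because the definition will be applied to polynomial
  sequences inside the group of all sequences. The commutator clause with one index 0 makes every
  \<open>A i\<close> normal in \<open>A 0\<close>.\<close>

definition filtration :: "('a, 'm) monoid_scheme \<Rightarrow> (nat \<Rightarrow> 'a set) \<Rightarrow> bool" where
  "filtration G A \<longleftrightarrow> (\<forall>i. subgroup (A i) G) \<and> (\<forall>i. A (Suc i) \<subseteq> A i)
     \<and> (\<forall>i j a b. a \<in> A i \<longrightarrow> b \<in> A j \<longrightarrow> commutator G a b \<in> A (i + j))"

definition seq_group :: "('a, 'm) monoid_scheme \<Rightarrow> (nat \<Rightarrow> 'a) monoid" where
  "seq_group G = \<lparr>carrier = {f. \<forall>n. f n \<in> carrier G},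
     monoid.mult = (\<lambda>f g n. f n \<otimes>\<^bsub>G\<^esub> g n), one = (\<lambda>n. \<one>\<^bsub>G\<^esub>)\<rparr>"

text \<open>The \<open>j\<close>-th difference of \<open>f\<close> lies in \<open>A (i + j)\<close> for all \<open>j \<le> r\<close>.\<close>

primrec poly_seq :: "('a, 'm) monoid_scheme \<Rightarrow> (nat \<Rightarrow> 'a set) \<Rightarrow> nat \<Rightarrow> nat \<Rightarrow> (nat \<Rightarrow> 'a) set" where
  "poly_seq G A 0 i = {f. \<forall>n. f n \<in> A i}"
| "poly_seq G A (Suc r) i =
     {f \<in> poly_seq G A r i. (\<lambda>n. inv\<^bsub>G\<^esub> f n \<otimes>\<^bsub>G\<^esub> f (Suc n)) \<in> poly_seq G A r (Suc i)}"

context group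
begin

lemma filtrationD:
  assumes "filtration G A"
  shows "subgroup (A i) G" "A (Suc i) \<subseteq> A i"
    "a \<in> A i \<Longrightarrow> b \<in> A j \<Longrightarrow> cm a b \<in> A (i + j)"
  using assms by (auto simp: filtration_def)

lemma filtration_antimono: "filtration G A \<Longrightarrow> i \<le> j \<Longrightarrow> A j \<subseteq> A i"
  by (rule lift_Suc_antimono_le[OF filtrationD(2)])

lemma filtration_carrier: "filtration G A \<Longrightarrow> a \<in> A i \<Longrightarrow> a \<in> carrier G"
  using filtrationD(1) by (blast dest: subgroup.mem_carrier)

lemma filtration_conjugate:
  assumes A: "filtration G A" and "a \<in> A i" "x \<in> A 0"
  shows "cj a x \<in> A i"
proof -
  have "cm a x \<in> A i" using filtrationD(3)[OF A assms(2,3)] by simp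
  then show ?thesis using assms filtration_carrier[OF A]
    by (auto simp: conjugate_eq intro: subgroup.m_closed[OF filtrationD(1)[OF A]])
qed

text \<open>Applied to the group of sequences with the shift \<open>s\<close>, this makes polynomial sequences a group
  (Lazard, Leibman).\<close>

lemma filtration_difference:
  assumes A: "filtration G A" and s: "s \<in> hom G G" and sA: "\<And>i a. a \<in> A i \<Longrightarrow> s a \<in> A i"
  shows "filtration G (\<lambda>i. {a \<in> A i. inv a \<otimes> s a \<in> A (Suc i)})"
proof -
  interpret s: group_hom G G s using s by unfold_locales
  note sub = filtrationD(1)[OF A]
  note [intro] = filtration_carrier[OF A] subgroup.m_closed[OF sub] subgroup.m_inv_closed[OF sub]
    subgroup.one_closed[OF sub]
  have A0: "a \<in> A i \<Longrightarrow> a \<in> A 0" for a i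
    using filtration_antimono[OF A, of 0 i] by auto
  let ?B = "\<lambda>i. {a \<in> A i. inv a \<otimes> s a \<in> A (Suc i)}"
  have "subgroup (?B i) G" for i
  proof (rule subgroupI)
    show "?B i \<noteq> {}"
      using subgroup.one_closed[OF sub] by (auto intro!: exI[of _ \<one>])
  next
    fix a assume a: "a \<in> ?B i"
    then have [simp]: "a \<in> carrier G" by auto
    have "inv (inv a) \<otimes> s (inv a) = cj (inv (inv a \<otimes> s a)) (inv a)"
      by (simp add: word_simps)
    also have "\<dots> \<in> A (Suc i)"
      using a A0 by (intro filtration_conjugate[OF A]) auto
    finally show "inv a \<in> ?B i" using a by auto
  next
    fix a b assume ab: "a \<in> ?B i" "b \<in> ?B i"
    then have [simp]: "a \<in> carrier G" "b \<in> carrier G" by auto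
    have "inv (a \<otimes> b) \<otimes> s (a \<otimes> b) = cj (inv a \<otimes> s a) b \<otimes> (inv b \<otimes> s b)"
      by (simp add: word_simps)
    also have "\<dots> \<in> A (Suc i)"
      using ab A0 by (intro subgroup.m_closed[OF sub, OF filtration_conjugate[OF A]]) blast+
    finally show "a \<otimes> b \<in> ?B i" using ab by auto
  qed auto
  moreover have "?B (Suc i) \<subseteq> ?B i" for i
    using filtrationD(2)[OF A] by auto
  moreover have "cm g h \<in> ?B (i + j)" if g: "g \<in> ?B i" and h: "h \<in> ?B j" for i j g h
  proof -
    define a where "a = inv g \<otimes> s g"
    define b where "b = inv h \<otimes> s h"
    define k where "k = cm g h"
    have a: "a \<in> A (Suc i)" and b: "b \<in> A (Suc j)" and g': "g \<in> A i" and h': "h \<in> A j"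
      using g h by (auto simp: a_def b_def)
    have [simp]: "g \<in> carrier G" "h \<in> carrier G" "a \<in> carrier G" "b \<in> carrier G"
      using a b g' h' by auto
    have sg: "s g = g \<otimes> a" and sh: "s h = h \<otimes> b"
      by (simp_all add: a_def b_def word_simps)
    let ?N = "A (Suc (i + j))"
    have k: "k \<in> A (i + j)"
      unfolding k_def by (rule filtrationD(3)[OF A g' h'])
    then have [simp]: "k \<in> carrier G" by auto
    have le: "x \<in> ?N" if "x \<in> A m" "m \<ge> Suc (i + j)" for x m
      using that filtration_antimono[OF A] by blast
    have hb: "h \<otimes> b \<in> A j" using h' b filtrationD(2)[OF A] by blast
    have t: "cm a (h \<otimes> b) \<in> ?N" using filtrationD(3)[OF A a hb] by simp
    have p: "cm g b \<in> ?N" using filtrationD(3)[OF A g' b] by simp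
    have r: "cm k b \<in> ?N" by (rule le[OF filtrationD(3)[OF A k b]]) simp
    have q: "cm k a \<in> ?N" by (rule le[OF filtrationD(3)[OF A k a]]) simp
    have "inv k \<otimes> s k = inv k \<otimes> cm (g \<otimes> a) (h \<otimes> b)"
      by (simp add: k_def commutator_def sg[symmetric] sh[symmetric])
    \<comment> \<open>The product rules leave exactly one factor without \<open>a\<close> or
      \<open>b\<close>, namely \<open>k\<close>, and it cancels against \<open>inv k\<close>. Each
      surviving factor involves \<open>a\<close> or \<open>b\<close>, whose degree is one higher
      than that of \<open>g\<close> or \<open>h\<close>.\<close>
    also have "cm (g \<otimes> a) (h \<otimes> b) = cj (cm g b \<otimes> (k \<otimes> cm k b)) a \<otimes> cm a (h \<otimes> b)"
      by (simp add: k_def word_simps)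
    also have "inv k \<otimes> \<dots> = cj (cj (cm g b) a) k \<otimes> (cm k a \<otimes> cj (cm k b) a) \<otimes> cm a (h \<otimes> b)"
      by (simp add: word_simps)
    also have "\<dots> \<in> ?N"
      using A0 k a p q r t
      by (intro subgroup.m_closed[OF sub] filtration_conjugate[OF A]) blast+
    finally show ?thesis using k by (simp add: k_def)
  qed
  ultimately show ?thesis unfolding filtration_def by blast
qed

lemma group_seq_group: "group (seq_group G)"
proof (rule groupI)
  fix f assume "f \<in> carrier (seq_group G)"
  then show "\<exists>g\<in>carrier (seq_group G). g \<otimes>\<^bsub>seq_group G\<^esub> f = \<one>\<^bsub>seq_group G\<^esub>"
    by (intro bexI[of _ "\<lambda>n. inv f n"]) (auto simp: seq_group_def)
qed (auto simp: seq_group_def m_assoc)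

lemma mult_seq_group: "f \<otimes>\<^bsub>seq_group G\<^esub> g = (\<lambda>n. f n \<otimes> g n)"
  by (simp add: seq_group_def)

lemma inv_seq_group:
  assumes "f \<in> carrier (seq_group G)"
  shows "inv\<^bsub>seq_group G\<^esub> f = (\<lambda>n. inv f n)"
  using assms by (intro group.inv_equality[OF group_seq_group]) (auto simp: seq_group_def)

lemma commutator_seq_group:
  assumes "f \<in> carrier (seq_group G)" "g \<in> carrier (seq_group G)"
  shows "commutator (seq_group G) f g = (\<lambda>n. cm (f n) (g n))"
  using assms by (simp add: commutator_def inv_seq_group mult_seq_group)

lemma filtration_seq_group:
  assumes A: "filtration G A"
  shows "filtration (seq_group G) (\<lambda>i. {f. \<forall>n. f n \<in> A i})"
proof -
  note sub = filtrationD(1)[OF A]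
  have c: "f \<in> carrier (seq_group G)" if "\<And>n. f n \<in> A i" for f i
    using that filtration_carrier[OF A] by (auto simp: seq_group_def)
  have "subgroup {f. \<forall>n. f n \<in> A i} (seq_group G)" for i
  proof (rule group.subgroupI[OF group_seq_group])
    show "{f. \<forall>n. f n \<in> A i} \<noteq> {}"
      using subgroup.one_closed[OF sub] by (auto intro!: exI[of _ "\<lambda>_. \<one>"])
  qed (use c[of _ i] subgroup.m_closed[OF sub] subgroup.m_inv_closed[OF sub]
      in \<open>auto simp: mult_seq_group inv_seq_group\<close>)
  moreover have "commutator (seq_group G) a b n \<in> A (i + j)"
    if "\<forall>n. a n \<in> A i" "\<forall>n. b n \<in> A j" for a b i j n
    using that c[of a i] c[of b j] filtrationD(3)[OF A] by (simp add: commutator_seq_group)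
  ultimately show ?thesis
    using filtrationD(2)[OF A] unfolding filtration_def by blast
qed

lemma shift_hom: "(\<lambda>f n. f (Suc n)) \<in> hom (seq_group G) (seq_group G)"
  by (auto simp: hom_def seq_group_def)

lemma poly_seq_shift: "f \<in> poly_seq G A r i \<Longrightarrow> (\<lambda>n. f (Suc n)) \<in> poly_seq G A r i"
  by (induction r arbitrary: i f) auto

lemma filtration_poly_seq:
  assumes A: "filtration G A"
  shows "filtration (seq_group G) (poly_seq G A r)"
proof (induction r)
  case 0
  show ?case using filtration_seq_group[OF A] by simp
next
  case (Suc r)
  interpret S: group "seq_group G" by (rule group_seq_group)
  have c: "f \<in> poly_seq G A r i \<Longrightarrow> f \<in> carrier (seq_group G)" for f i
    by (rule S.filtration_carrier[OF Suc])
  have "poly_seq G A (Suc r) = (\<lambda>i. {f \<in> poly_seq G A r i.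
      inv\<^bsub>seq_group G\<^esub> f \<otimes>\<^bsub>seq_group G\<^esub> (\<lambda>n. f (Suc n)) \<in> poly_seq G A r (Suc i)})"
    using c by (intro ext) (auto simp: inv_seq_group mult_seq_group cong: conj_cong)
  with S.filtration_difference[OF Suc shift_hom poly_seq_shift] show ?case by simp
qed

lemma poly_seq_mult:
  assumes "filtration G A" "f \<in> poly_seq G A r i" "g \<in> poly_seq G A r i"
  shows "(\<lambda>n. f n \<otimes> g n) \<in> poly_seq G A r i"
  using subgroup.m_closed[OF group.filtrationD(1)[OF group_seq_group filtration_poly_seq[OF assms(1)]] assms(2,3)]
  by (simp add: mult_seq_group)

lemma poly_seq_inv:
  assumes "filtration G A" "f \<in> poly_seq G A r i"
  shows "(\<lambda>n. inv f n) \<in> poly_seq G A r i"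
  using subgroup.m_inv_closed[OF group.filtrationD(1)[OF group_seq_group filtration_poly_seq[OF assms(1)]] assms(2)]
    group.filtration_carrier[OF group_seq_group filtration_poly_seq[OF assms(1)] assms(2)]
  by (simp add: inv_seq_group)

text \<open>Pascal's rule: the difference of the sequence for \<open>k\<close> is the sequence for
  \<open>k - 1\<close> with the same \<open>c\<close>, so the index drops by one while the required
  degree rises by one. For \<open>k = 0\<close> the sequence is constant.\<close>

lemma poly_seq_binomial:
  assumes A: "filtration G A" and "c \<in> A (i + k)"
  shows "(\<lambda>n. c [^] (n choose k)) \<in> poly_seq G A r i"
  using assms(2)
proof (induction r arbitrary: i k c)
  case 0
  have "c \<in> A i" using 0 filtration_antimono[OF A, of i "i + k"] by auto
  then have "c [^] (m::nat) \<in> A i" for m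
    using subgroup.one_closed[OF filtrationD(1)[OF A]] subgroup.m_closed[OF filtrationD(1)[OF A]]
    by (induction m) auto
  then show ?case by simp
next
  case (Suc r)
  have c: "c \<in> carrier G" using Suc.prems filtration_carrier[OF A] by blast
  show ?case
  proof (cases k)
    case 0
    have "(\<lambda>n. \<one> [^] (n choose 0)) \<in> poly_seq G A r (Suc i)"
      using subgroup.one_closed[OF filtrationD(1)[OF A]] by (intro Suc.IH) simp
    then show ?thesis using Suc.IH[OF Suc.prems] c 0 by simp
  next
    case (Suc k')
    have "inv (c [^] (n choose k)) \<otimes> c [^] (Suc n choose k) = c [^] (n choose k')" for n
    proof -
      have "c [^] (Suc n choose k) = c [^] (n choose k) \<otimes> c [^] (n choose k')"
        using c by (simp add: Suc add.commute flip: pow_add)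
      then show ?thesis using c by (simp add: inv_cancel_left)
    qed
    then show ?thesis using Suc.IH[OF Suc.prems] Suc.IH[of c "Suc i" k'] Suc.prems Suc by simp
  qed
qed

text \<open>If \<open>f\<close> is trivial up to \<open>k\<close>, its difference is trivial below
  \<open>k\<close> and equals \<open>f (Suc k)\<close> at \<open>k\<close>. Thus the first value not
  assumed trivial is an iterated difference at 0.\<close>

lemma poly_seq_vanishing:
  assumes A: "filtration G A" and "f \<in> poly_seq G A r i" "\<And>j. j < k \<Longrightarrow> f j = \<one>" "k \<le> r"
  shows "f k \<in> A (i + k)"
  using assms(2-4)
proof (induction k arbitrary: r i f)
  case 0
  have "poly_seq G A r i \<subseteq> poly_seq G A 0 i" by (induction r) auto
  then show ?case using 0 by auto
next
  case (Suc k)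
  then obtain r' where r: "r = Suc r'" by (cases r) auto
  let ?g = "\<lambda>n. inv f n \<otimes> f (Suc n)"
  have "poly_seq G A r i \<subseteq> poly_seq G A 0 i" by (induction r) auto
  then have c: "f n \<in> carrier G" for n using Suc.prems(1) filtration_carrier[OF A] by auto
  have "?g k \<in> A (Suc i + k)"
    using Suc.prems r by (intro Suc.IH[of ?g r']) auto
  then show ?case using Suc.prems(2) c by simp
qed

text \<open>Once \<open>s\<close> consecutive values are trivial, \<open>poly_seq_vanishing\<close>
  applied to the sequence shifted to their start puts the next value into \<open>A s\<close>, which
  is trivial.\<close>

lemma poly_seq_eq_one:
  assumes A: "filtration G A" and "A s = {\<one>}" "f \<in> poly_seq G A s 0" "\<And>j. j < s \<Longrightarrow> f j = \<one>"
  shows "f n = \<one>"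
proof -
  have shift: "(\<lambda>n. f (n + m)) \<in> poly_seq G A s 0" for m
    by (induction m) (use assms(3) in \<open>auto dest: poly_seq_shift\<close>)
  show ?thesis
  proof (induction n rule: less_induct)
    case (less n)
    show ?case
    proof (cases "n < s")
      case False
      have "f (s + (n - s)) \<in> A (0 + s)"
        using less False by (intro poly_seq_vanishing[OF A shift]) auto
      then show ?thesis using False assms(2) by simp
    qed (use assms(4) in blast)
  qed
qed

text \<open>Truncated subtraction makes degrees 0 and 1 both the whole group, and degree
  \<open>i \<ge> 1\<close> is \<open>\<gamma>\<^sub>i\<close>. This is what makes n -> x^n
  polynomial: its difference is the constant \<open>x\<close>, of degree 1.\<close>

lemma filtration_lower_central: "filtration G (\<lambda>i. lower_central G (i - 1))"
  unfolding filtration_def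
proof (intro conjI allI impI)
  fix i j a b assume ab: "a \<in> lower_central G (i - 1)" "b \<in> lower_central G (j - 1)"
  show "cm a b \<in> lower_central G (i + j - 1)"
  proof (cases "i = 0 \<or> j = 0")
    case True
    then show ?thesis
      using ab normal_commutator[OF normal_lower_central] lower_central_carrier by auto
  next
    case False
    then have "Suc (i - 1 + (j - 1)) = i + j - 1" by arith
    then show ?thesis using commutator_lower_central_lower_central[OF ab] by metis
  qed
qed (use lower_central_antimono subgroup_lower_central in auto)

section \<open>The Hall-Petrescu formula in class five, relative to a normal subgroup\<close>

lemma pow_mult_remainder:
  assumes D: "D \<lhd> G" and x: "x \<in> carrier G" and y: "y \<in> D"
  shows "inv (y [^] n) \<otimes> inv (x [^] n) \<otimes> (x \<otimes> y) [^] (n::nat) \<in> D"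
proof -
  have D': "subgroup D G" using D by (rule normal_imp_subgroup)
  have yc: "y \<in> carrier G" using D' y by (rule subgroup.mem_carrier)
  \<comment> \<open>Modulo \<open>D\<close> the factor \<open>y\<close> disappears. Later
    \<open>D\<close> is the exterior square inside the semidirect product, and this keeps all
    correction terms there.\<close>
  have "inv (x [^] n) \<otimes> (x \<otimes> y) [^] n \<in> D"
  proof (induction n)
    case 0
    show ?case using subgroup.one_closed[OF D'] by simp
  next
    case (Suc n)
    have "inv (x [^] Suc n) \<otimes> (x \<otimes> y) [^] Suc n = cj (inv (x [^] n) \<otimes> (x \<otimes> y) [^] n) x \<otimes> y"
      using x yc by (simp add: word_simps)
    then show ?case
      using Suc x y by (simp add: subgroup.m_closed[OF D'] normal_conjugate[OF D])
  qed
  moreover have "inv (y [^] n) \<in> D"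
    using y D' yc subgroup.one_closed[OF D'] subgroup.m_closed[OF D']
    by (intro subgroup.m_inv_closed[OF D']) (induction n, auto)
  ultimately show ?thesis
    using x yc by (simp add: m_assoc subgroup.m_closed[OF D'])
qed

text \<open>The coefficient of \<open>n choose k\<close> is the value at \<open>k\<close> of the polynomial sequence
  \<open>y\<^sup>-\<^sup>n x\<^sup>-\<^sup>n (x y)\<^sup>n\<close> after the lower terms have been divided off.\<close>

theorem Hall_Petrescu_5:
  fixes x y
  defines "u \<equiv> cm y x"
  assumes triv: "lower_central G 5 = {\<one>}"
    and x: "x \<in> carrier G" and y: "y \<in> D" and D: "D \<lhd> G"
  obtains c4 c5 where
    "\<forall>n. (x \<otimes> y) [^] (n::nat) = x [^] n \<otimes> y [^] n \<otimes> (cj u y [^] (n choose 2)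
       \<otimes> cj (inv (u \<otimes> u \<otimes> u) \<otimes> cj (u \<otimes> cj u x) y \<otimes> u) y [^] (n choose 3)
       \<otimes> c4 [^] (n choose 4) \<otimes> c5 [^] (n choose 5))"
    "cj (inv (u \<otimes> u \<otimes> u) \<otimes> cj (u \<otimes> cj u x) y \<otimes> u) y \<in> lower_central G 2"
    "c4 \<in> lower_central G 3" "c4 \<in> D" "c5 \<in> lower_central G 4" "c5 \<in> D"
proof -
  define A where "A = (\<lambda>i. lower_central G (i - 1))"
  have A: "filtration G A" unfolding A_def by (rule filtration_lower_central)
  have D': "subgroup D G" using D by (rule normal_imp_subgroup)
  have yc [simp]: "y \<in> carrier G" using D' y by (rule subgroup.mem_carrier)
  have xc [simp]: "x \<in> carrier G" by (rule x)
  have uc [simp]: "u \<in> carrier G" by (simp add: u_def)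
  note sub = filtrationD(1)[OF A]
  \<comment> \<open>The degree is 6 because \<open>A 6\<close> is \<open>lower_central G 5\<close>,
    the trivial term.\<close>
  let ?P = "poly_seq G A 6 0"
  note P_mult = poly_seq_mult[OF A, of _ 6 0]
  have D_pow: "c \<in> D \<Longrightarrow> c [^] (n::nat) \<in> D" for c n
    using subgroup.one_closed[OF D'] subgroup.m_closed[OF D'] by (induction n) auto
  define f1 where "f1 = (\<lambda>n::nat. inv (y [^] n) \<otimes> inv (x [^] n) \<otimes> (x \<otimes> y) [^] n)"
  have pw: "(\<lambda>n. z [^] n) \<in> ?P" if "z \<in> carrier G" for z
    using poly_seq_binomial[OF A, of z 0 1 6] that by (simp add: A_def)
  have f1P: "f1 \<in> ?P" unfolding f1_def
    by (intro P_mult poly_seq_inv[OF A] pw) simp_all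
  have f1D: "f1 n \<in> D" for n
    unfolding f1_def using pow_mult_remainder[OF D x y] by simp
  \<comment> \<open>One division step: the binomial sequence with coefficient \<open>f k\<close>
    vanishes below \<open>k\<close> and equals \<open>f k\<close> at \<open>k\<close>, so the
    quotient also vanishes at \<open>k\<close>. It stays polynomial because polynomial sequences
    form a group.\<close>
  have step: "(\<lambda>n. inv (f k [^] (n choose k)) \<otimes> f n) \<in> ?P \<and> f k \<in> A k
      \<and> (\<forall>n. inv (f k [^] (n choose k)) \<otimes> f n \<in> D)
      \<and> (\<forall>j<Suc k. inv (f k [^] (j choose k)) \<otimes> f j = \<one>)
      \<and> (\<forall>n. f n = f k [^] (n choose k) \<otimes> (inv (f k [^] (n choose k)) \<otimes> f n))"
    if f: "f \<in> ?P" "\<And>n. f n \<in> D" "\<And>j. j < k \<Longrightarrow> f j = \<one>" and k: "k < 6" for f k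
  proof -
    have fk: "f k \<in> A (0 + k)" using f k by (intro poly_seq_vanishing[OF A]) auto
    have fc: "f n \<in> carrier G" for n using f(2) D' by (rule subgroup.mem_carrier[rotated])
    have "(\<lambda>n. inv (f k [^] (n choose k)) \<otimes> f n) \<in> ?P"
      using fk by (intro P_mult f poly_seq_inv[OF A] poly_seq_binomial[OF A]) simp
    moreover have "inv (f k [^] (n choose k)) \<otimes> f n \<in> D" for n
      using f(2) D_pow by (simp add: subgroup.m_closed[OF D'] subgroup.m_inv_closed[OF D'])
    moreover have "inv (f k [^] (j choose k)) \<otimes> f j = \<one>" if "j < Suc k" for j
      using that f(3) fc by (cases "j = k") (auto simp: binomial_eq_0)
    ultimately show ?thesis using fk fc by (simp add: inv_cancel_left)
  qed
  have f1_01: "f1 j = \<one>" if "j < 2" for j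
    using that by (cases j) (auto simp: f1_def word_simps)
  define f2 where "f2 = (\<lambda>n. inv (f1 2 [^] (n choose 2)) \<otimes> f1 n)"
  note s1 = step[OF f1P f1D f1_01, of 2, folded f2_def, simplified]
  define f3 where "f3 = (\<lambda>n. inv (f2 3 [^] (n choose 3)) \<otimes> f2 n)"
  have "f2 \<in> ?P" "\<And>n. f2 n \<in> D" "\<And>j. j < 3 \<Longrightarrow> f2 j = \<one>"
    using s1 by (auto simp: f2_def)
  note s2 = step[OF this, of 3, folded f3_def, simplified]
  define f4 where "f4 = (\<lambda>n. inv (f3 4 [^] (n choose 4)) \<otimes> f3 n)"
  have "f3 \<in> ?P" "\<And>n. f3 n \<in> D" "\<And>j. j < 4 \<Longrightarrow> f3 j = \<one>"
    using s2 by (auto simp: f3_def)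
  note s3 = step[OF this, of 4, folded f4_def, simplified]
  define f5 where "f5 = (\<lambda>n. inv (f4 5 [^] (n choose 5)) \<otimes> f4 n)"
  have f4: "f4 \<in> ?P" "\<And>n. f4 n \<in> D" "\<And>j. j < 5 \<Longrightarrow> f4 j = \<one>"
    using s3 by (auto simp: f4_def)
  note s4 = step[OF this, of 5, folded f5_def, simplified]
  have f5: "f5 n = \<one>" for n
  proof (rule poly_seq_eq_one[OF A])
    show "f5 \<in> ?P" "A 6 = {\<one>}" using s4 triv by (simp_all add: A_def)
    show "f5 j = \<one>" if "j < 6" for j using s4 that by (simp add: f5_def)
  qed
  have c2: "f1 2 = cj u y"
    by (simp add: f1_def u_def numeral_2_eq_2 word_simps)
  \<comment> \<open>At n = 3 the weight 2 coefficient occurs with exponent 3, which gives the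
    inverse of \<open>u \<otimes> u \<otimes> u\<close>. The rest is y^-3 x^-3 (x y)^3, rewritten
    with u u^x = [y, x^2].\<close>
  have c3: "f2 3 = cj (inv (u \<otimes> u \<otimes> u) \<otimes> cj (u \<otimes> cj u x) y \<otimes> u) y"
    by (simp add: f2_def c2 numeral_3_eq_3 numeral_2_eq_2) (simp add: f1_def u_def word_simps)
  have fc: "f1 n \<in> carrier G" "f2 n \<in> carrier G" "f3 n \<in> carrier G" "f4 n \<in> carrier G" for n
    using s1 s2 s3 f4 f1D subgroup.mem_carrier[OF D'] \<open>\<And>n. f2 n \<in> D\<close> \<open>\<And>n. f3 n \<in> D\<close> by auto
  show thesis
  proof (rule that[of "f3 4" "f4 5"], rule allI)
    fix n :: nat
    have "(x \<otimes> y) [^] n = x [^] n \<otimes> y [^] n \<otimes> f1 n"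
      by (simp add: f1_def word_simps)
    also have "f1 n = f1 2 [^] (n choose 2) \<otimes> f2 n" using fc by (simp add: f2_def inv_cancel_left)
    also have "f2 n = f2 3 [^] (n choose 3) \<otimes> f3 n" using fc by (simp add: f3_def inv_cancel_left)
    also have "f3 n = f3 4 [^] (n choose 4) \<otimes> f4 n" using fc by (simp add: f4_def inv_cancel_left)
    also have "f4 n = f4 5 [^] (n choose 5) \<otimes> f5 n" using fc by (simp add: f5_def inv_cancel_left)
    finally show "(x \<otimes> y) [^] n = x [^] n \<otimes> y [^] n \<otimes> (cj u y [^] (n choose 2)
       \<otimes> cj (inv (u \<otimes> u \<otimes> u) \<otimes> cj (u \<otimes> cj u x) y \<otimes> u) y [^] (n choose 3)
       \<otimes> f3 4 [^] (n choose 4) \<otimes> f4 5 [^] (n choose 5))"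
      using fc unfolding c2[symmetric] c3[symmetric] by (simp add: f5 m_assoc)
  next
    show "cj (inv (u \<otimes> u \<otimes> u) \<otimes> cj (u \<otimes> cj u x) y \<otimes> u) y \<in> lower_central G 2"
      using s2 unfolding c3 A_def by simp
    show "f3 4 \<in> lower_central G 3" using s3 unfolding A_def by simp
    show "f4 5 \<in> lower_central G 4" using s4 unfolding A_def by simp
  qed (rule \<open>\<And>n. f3 n \<in> D\<close> f4(2))+
qed

end

section \<open>Groups of exponent a power of three and class at most five\<close>

text \<open>In k (n choose k) = n (n-1 choose k-1) the factor \<open>k\<close> can be cancelled
  modulo \<open>n\<close>.\<close>

lemma dvd_binomial_coprime:
  assumes "coprime n k" "k > 0"
  shows "n dvd (n choose k)"
proof (cases n)
  case (Suc m)
  obtain j where k: "k = Suc j" using assms(2) by (cases k) auto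
  have "n dvd k * (n choose k)"
    using Suc_times_binomial[of j m] Suc k by (metis dvd_triv_left)
  then show ?thesis using assms(1) by (simp add: coprime_dvd_mult_right_iff)
qed (use assms in auto)

text \<open>The indices 2, 4 and 5 are prime to 3. For index 3, 3 (e choose 3) = e (e-1 choose 2)
  costs one factor 3, and no more: (e-1)(e-2) is 2 modulo 3.\<close>

lemma binomial_three_power:
  fixes e q :: nat
  assumes q: "q = 3 ^ k" and e: "e = 3 * q"
  shows "e dvd (e choose 2)" "e dvd (e choose 4)" "e dvd (e choose 5)"
    "(e choose 3) = q * ((e - 1) choose 2)" "coprime ((e - 1) choose 2) 3"
proof -
  have e': "e = 3 ^ Suc k" using q e by simp
  have c: "coprime (3::nat) 2" "coprime (3::nat) 4" "coprime (3::nat) 5" by (simp_all add: coprime_iff_gcd_eq_1 gcd_non_0_nat)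
  show "e dvd (e choose 2)" "e dvd (e choose 4)" "e dvd (e choose 5)"
    using c by (auto intro!: dvd_binomial_coprime simp: e' simp del: power_Suc)
  have "3 * (e choose 3) = e * ((e - 1) choose 2)"
    using Suc_times_binomial[of 2 "e - 1"] q e by (simp add: numeral_3_eq_3 numeral_2_eq_2)
  then show "(e choose 3) = q * ((e - 1) choose 2)" using e by simp
  have "2 * ((e - 1) choose 2) = (e - 1) * (e - 2)"
    by (simp add: choose_two) (simp add: numeral_2_eq_2)
  moreover have "\<not> 3 dvd (e - 1) * (e - 2)"
  proof -
    obtain m where "e = m + 3" "3 dvd m" using q e by (metis dvd_add_triv_right_iff dvd_triv_left le_add_diff_inverse2 mult_le_mono2 nat_mult_1_right one_le_numeral one_le_power)
    then have "\<not> 3 dvd (e - 1)" "\<not> 3 dvd (e - 2)" by presburger+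
    then show ?thesis by (simp add: prime_dvd_mult_iff)
  qed
  ultimately have "\<not> 3 dvd ((e - 1) choose 2)" by (metis dvd_mult)
  then show "coprime ((e - 1) choose 2) 3"
    using prime_imp_coprime[of 3 "(e - 1) choose 2"] by (simp add: coprime_commute)
qed

context group
begin

lemma pow_eq_one_dvd:
  assumes "x \<in> carrier G" "x [^] (a::nat) = \<one>" "a dvd b"
  shows "x [^] b = \<one>"
  using assms by (metis dvd_trans pow_eq_id)

lemma pow_coprime_eq_one:
  assumes "x \<in> carrier G" "x [^] (a::nat) = \<one>" "x [^] (b::nat) = \<one>" "coprime a b"
  shows "x = \<one>"
proof -
  have "ord x dvd 1" using assms by (metis coprime_common_divisor pow_eq_id)
  then show ?thesis using assms(1) by (metis pow_eq_id nat_pow_eone)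
qed

section \<open>2-Engel groups of odd exponent\<close>

lemma commutator_self [simp]: "x \<in> carrier G \<Longrightarrow> cm x x = \<one>"
  by (simp add: commutator_eq_one_iff)

lemma conjugate_commuting:
  "x \<in> carrier G \<Longrightarrow> y \<in> carrier G \<Longrightarrow> x \<otimes> y = y \<otimes> x \<Longrightarrow> cj x y = x"
  by (simp add: conjugate_def m_assoc inv_cancel_left)

text \<open>Comparing the law for \<open>x\<close> and for \<open>x\<inverse>\<close> shows that \<open>x\<close> commutes with \<open>[y, x\<^sup>2]\<close>; in odd exponent
  every element is a square.\<close>

lemma two_Engel_of_law:
  assumes law: "\<And>x y. x \<in> carrier G \<Longrightarrow> y \<in> carrier G \<Longrightarrow>
      cj (cm y x \<otimes> cj (cm y x) x) y = cm y x \<otimes> cm y x"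
    and n: "odd n" "\<And>x. x \<in> carrier G \<Longrightarrow> x [^] (n::nat) = \<one>"
    and x: "x \<in> carrier G" and y: "y \<in> carrier G"
  shows "cm (cm y x) x = \<one>"
proof -
  have sq: "cm (cm y (x \<otimes> x)) x = \<one>" if [simp]: "x \<in> carrier G" for x
  proof -
    note [simp] = y
    define u where "u = cm y x"
    define v where "v = cm y (inv x)"
    have u [simp]: "u \<in> carrier G" by (simp add: u_def)
    have v: "v = cj (inv u) (inv x)" by (simp add: u_def v_def word_simps)
    have 1: "cj u y \<otimes> cj u (x \<otimes> y) = u \<otimes> u"
      using law[of x y] by (simp flip: u_def add: conjugate_mult conjugate_conjugate)
    have "cj u (inv x \<otimes> y) \<otimes> cj u y = cj (inv (cj (v \<otimes> cj v (inv x)) y)) (inv y \<otimes> x \<otimes> y)"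
      by (simp add: v word_simps)
    also have "cj (v \<otimes> cj v (inv x)) y = v \<otimes> v"
      using law[of "inv x" y] by (simp add: v_def)
    \<comment> \<open>The inverse of \<open>v\<close> is \<open>u\<close> conjugated by x^-1, and
      x^-1 y^-1 x y = [x, y] is the inverse of \<open>u\<close>.\<close>
    also have "cj (inv (v \<otimes> v)) (inv y \<otimes> x \<otimes> y) = cj (u \<otimes> u) (inv u)"
      by (simp add: v) (simp add: u_def word_simps)
    also have "\<dots> = u \<otimes> u" by (simp add: word_simps)
    finally have "cj u (inv x \<otimes> y) \<otimes> cj u y = cj u y \<otimes> cj u (x \<otimes> y)" using 1 by simp
    then have "cj (cj u (inv x \<otimes> y) \<otimes> cj u y) (inv y \<otimes> x) = cj (cj u y \<otimes> cj u (x \<otimes> y)) (inv y \<otimes> x)"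
      by simp
    moreover have "cj (cj u (inv x \<otimes> y) \<otimes> cj u y) (inv y \<otimes> x) = u \<otimes> cj u x"
      "cj (cj u y \<otimes> cj u (x \<otimes> y)) (inv y \<otimes> x) = cj (u \<otimes> cj u x) x"
      by (simp_all add: word_simps)
    ultimately have "u \<otimes> cj u x = cj (u \<otimes> cj u x) x" by simp
    moreover have "u \<otimes> cj u x = cm y (x \<otimes> x)" by (simp add: u_def word_simps)
    ultimately have "cj (cm y (x \<otimes> x)) x = cm y (x \<otimes> x)" by simp
    then show ?thesis using conjugate_eq[of "cm y (x \<otimes> x)" x] by simp
  qed
  obtain m where m: "n = 2 * m + 1" using n(1) by (rule oddE)
  let ?z = "x [^] (m + 1)"
  have z: "?z \<otimes> ?z = x"
  proof -
    have "?z \<otimes> ?z = x [^] Suc n" using x by (simp only: nat_pow_mult) (simp add: m mult_2)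
    then show ?thesis using n(2)[OF x] x by simp
  qed
  \<comment> \<open>Since \<open>x\<close> is the square of \<open>?z\<close>, the relation is about
    [y, x] itself, and \<open>?z\<close> commutes with it; then so does \<open>x\<close>.\<close>
  have "cm (cm y x) ?z = \<one>" using sq[of ?z] x z by simp
  then have "cm (cm y x) (?z \<otimes> ?z) = \<one>"
    using x y by (subst commutator_mult_right) simp_all
  then show ?thesis using z by simp
qed

text \<open>With \<open>Y = y - 1\<close> and \<open>Z = z - 1\<close> in the endomorphism ring of \<open>A\<close>, the Engel condition reads
  \<open>Y\<^sup>2 = Z\<^sup>2 = (Y + Z + Y Z)\<^sup>2 = 0\<close>, which gives \<open>Z Y Z = 0\<close> and \<open>Y Z = - Z Y\<close>.\<close>

lemma two_Engel_action:
  assumes A: "A \<lhd> G" and ab: "\<And>a b. a \<in> A \<Longrightarrow> b \<in> A \<Longrightarrow> a \<otimes> b = b \<otimes> a"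
    and E: "\<And>a y. a \<in> A \<Longrightarrow> y \<in> carrier G \<Longrightarrow> cm (cm a y) y = \<one>"
    and a: "a \<in> A" and y: "y \<in> carrier G" and z: "z \<in> carrier G"
  shows "cm (cm a y) z = inv (cm (cm a z) y)" (is ?T1)
    and "cm a (cm y z) = cm (cm a y) z \<otimes> cm (cm a y) z" (is ?T2)
proof -
  have A': "subgroup A G" using A by (rule normal_imp_subgroup)
  have Ac: "a \<in> A \<Longrightarrow> a \<in> carrier G" for a using A' by (rule subgroup.mem_carrier)
  note m [intro] = subgroup.m_closed[OF A'] subgroup.m_inv_closed[OF A']
  have cmA [intro]: "cm a y \<in> A" if "a \<in> A" "y \<in> carrier G" for a y
    using normal_commutator(1)[OF A that] .
  have lin: "cm (a \<otimes> b) y = cm a y \<otimes> cm b y" if "a \<in> A" "b \<in> A" "y \<in> carrier G" for a b y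
  proof -
    have "cj (cm a y) b = cm a y"
      using that ab[of "cm a y" b] Ac cmA by (simp add: conjugate_def m_assoc inv_cancel_left)
    then show ?thesis using that Ac by (simp add: commutator_mult_left)
  qed
  have prod: "cm a (y \<otimes> z) = cm a z \<otimes> cm a y \<otimes> cm (cm a y) z"
    if "a \<in> A" "y \<in> carrier G" "z \<in> carrier G" for a y z
    using that Ac by (simp add: commutator_mult_right conjugate_eq m_assoc)
  define t where "t = (\<lambda>a y z. cm (cm a y) z)"
  have tA [intro]: "t a y z \<in> A" if "a \<in> A" "y \<in> carrier G" "z \<in> carrier G" for a y z
    using that by (auto simp: t_def)
  \<comment> \<open>With operators written on the right, \<open>t a y z\<close> is a Y Z. The
    identity is a (Y + Z + Y Z)^2 = 0 with Y^2 = Z^2 = 0 inserted, in multiplicative notation.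
    Replacing \<open>a\<close> by a Y or a Z in it and in its consequence \<open>zyz\<close> then
    removes the longer words.\<close>
  have main: "t a y z \<otimes> (t a z y \<otimes> cm (t a y z) y) \<otimes> (cm (t a z y) z \<otimes> cm (cm (t a y z) y) z) = \<one>"
    if a: "a \<in> A" and y: "y \<in> carrier G" and z: "z \<in> carrier G" for a y z
  proof -
    let ?b = "cm a z \<otimes> cm a y \<otimes> t a y z"
    have b: "?b = cm a (y \<otimes> z)" using prod[OF a y z] by (simp add: t_def)
    have bA: "?b \<in> A" using a y z by blast
    have 1: "cm ?b z = t a y z"
    proof -
      have "cm ?b z = cm (cm a z) z \<otimes> cm (cm a y) z \<otimes> cm (t a y z) z"
        using a y z by (subst lin, blast, blast, blast, subst lin) blast+
      then show ?thesis using a y z E[of a z] E[of "cm a y" z] Ac cmA by (simp add: t_def)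
    qed
    have 2: "cm ?b y = t a z y \<otimes> cm (t a y z) y"
    proof -
      have "cm ?b y = cm (cm a z) y \<otimes> cm (cm a y) y \<otimes> cm (t a y z) y"
        using a y z by (subst lin, blast, blast, blast, subst lin) blast+
      then show ?thesis using a y z E[of a y] Ac cmA by (simp add: t_def)
    qed
    have 3: "cm (cm ?b y) z = cm (t a z y) z \<otimes> cm (cm (t a y z) y) z"
      unfolding 2 using a y z by (intro lin) blast+
    have "cm ?b (y \<otimes> z) = \<one>" unfolding b using E a y z by simp
    then show ?thesis using prod[OF bA y z] unfolding 3 unfolding 2 1 by simp
  qed
  have yzy: "cm (t a y z) y \<otimes> cm (cm (t a y z) y) z = \<one>"
    if a: "a \<in> A" and y: "y \<in> carrier G" and z: "z \<in> carrier G" for a y z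
  proof -
    have "t (cm a y) y z = \<one>" "t (cm a y) z y = cm (t a y z) y"
      using E[OF a y] z by (simp_all add: t_def)
    moreover have "cm (t a y z) y \<in> carrier G" "cm (cm (t a y z) y) z \<in> carrier G"
      using a y z by (intro Ac; blast)+
    ultimately show ?thesis using main[of "cm a y" y z] a y z cmA by simp
  qed
  have zyz: "t a y z \<otimes> t a z y \<otimes> cm (t a z y) z = \<one>"
    if a: "a \<in> A" and y: "y \<in> carrier G" and z: "z \<in> carrier G" for a y z
  proof -
    let ?p = "cm (t a y z) y" and ?r = "cm (t a z y) z" and ?s = "cm (cm (t a y z) y) z"
    have in_A: "?p \<in> A" "?r \<in> A" "?s \<in> A" "t a y z \<in> A" "t a z y \<in> A" using a y z by blast+
    then have c: "?p \<in> carrier G" "?r \<in> carrier G" "?s \<in> carrier G" "t a y z \<in> carrier G" "t a z y \<in> carrier G"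
      using Ac by blast+
    have "t a y z \<otimes> t a z y \<otimes> ?r = t a y z \<otimes> (t a z y \<otimes> (?p \<otimes> ?s) \<otimes> ?r)"
      using yzy[OF a y z] c by (simp add: m_assoc)
    also have "\<dots> = t a y z \<otimes> (t a z y \<otimes> ?p) \<otimes> (?r \<otimes> ?s)"
      using c ab[OF in_A(3,2)] by (simp add: m_assoc)
    finally show ?thesis using main[OF a y z] by simp
  qed
  have vanish: "cm (t a z y) z = \<one>"
    if a: "a \<in> A" and y: "y \<in> carrier G" and z: "z \<in> carrier G" for a y z
  proof -
    have "t (cm a z) z y = \<one>" "t (cm a z) y z = cm (t a z y) z"
      using E[OF a z] y by (simp_all add: t_def)
    moreover have "cm (t a z y) z \<in> carrier G"
      using a y z by (intro Ac; blast)
    ultimately show ?thesis using zyz[of "cm a z" y z] a y z cmA by simp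
  qed
  have anti: "t a y z \<otimes> t a z y = \<one>"
    if a: "a \<in> A" and y: "y \<in> carrier G" and z: "z \<in> carrier G" for a y z
    using zyz[OF a y z] vanish[OF a y z] a y z Ac tA by simp
  have "inv (t a z y) = t a y z"
    using anti[OF a y z] Ac tA a y z by (intro inv_equality) auto
  then show ?T1 by (simp add: t_def)
  \<comment> \<open>Conjugating \<open>a\<close> adds a Y or a Z to it, and Y Y Z and Z Y Z both
    vanish.\<close>
  have t_cj: "t (cj a g) y z = t a y z"
    if a: "a \<in> A" and y: "y \<in> carrier G" and z: "z \<in> carrier G" and g: "g = y \<or> g = z" for a y z g
  proof -
    have "cj a g = a \<otimes> cm a g" using a y z g Ac by (auto simp: conjugate_eq)
    moreover have "t (a \<otimes> cm a g) y z = t a y z \<otimes> t (cm a g) y z"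
    proof -
      have "t (a \<otimes> cm a g) y z = cm (cm a y \<otimes> cm (cm a g) y) z"
        unfolding t_def using a y z g by (subst lin[of a]) auto
      also have "\<dots> = t a y z \<otimes> t (cm a g) y z"
        unfolding t_def using a y z g by (subst lin) auto
      finally show ?thesis .
    qed
    moreover have "t (cm a g) y z = \<one>"
      using g E[OF a y] vanish[OF a y z] z by (auto simp: t_def)
    ultimately show ?thesis using a y z Ac tA by simp
  qed
  let ?c = "cm y z"
  \<comment> \<open>Let C be the operator of \<open>?c\<close>. From y z = z y [y, z] one gets Y Z -
    Z Y = (1 + Z) (1 + Y) C. Starting from \<open>b\<close>, chosen with b (1 + Z) (1 + Y) = a, the
    right side becomes a C, while \<open>t_cj\<close> identifies b Y Z with a Y Z.\<close>
  define b where "b = cj a (inv (z \<otimes> y))"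
  have b: "b \<in> A" unfolding b_def using a y z by (intro normal_conjugate[OF A]) auto
  have ba: "cj b (z \<otimes> y) = a" using a y z Ac by (simp add: b_def conjugate_conjugate)
  have bA: "cj b z \<in> A" using b z by (rule normal_conjugate[OF A])
  have tb: "t b y z = t a y z"
    using t_cj[OF b y z, of z] t_cj[OF bA y z, of y] y z b Ac by (simp add: conjugate_conjugate ba)
  have "z \<otimes> y \<otimes> ?c = y \<otimes> z" using y z by (simp add: word_simps)
  then have "cm b (y \<otimes> z) = cm b ?c \<otimes> cj (cm b (z \<otimes> y)) ?c"
    using b y z Ac commutator_mult_right[of b "z \<otimes> y" ?c] by simp
  also have "\<dots> = cm (b \<otimes> cm b (z \<otimes> y)) ?c \<otimes> cm b (z \<otimes> y)"
  proof -
    have d: "cm b (z \<otimes> y) \<in> A" "cm b ?c \<in> A" "cm (cm b (z \<otimes> y)) ?c \<in> A" using b y z by auto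
    then have "cj (cm b (z \<otimes> y)) ?c = cm (cm b (z \<otimes> y)) ?c \<otimes> cm b (z \<otimes> y)"
      using y z Ac ab by (simp add: conjugate_eq)
    then show ?thesis using lin[OF b d(1), of ?c] d y z Ac by (simp add: m_assoc)
  qed
  also have "b \<otimes> cm b (z \<otimes> y) = a"
    using conjugate_eq[of b "z \<otimes> y"] b y z Ac ba by simp
  finally have eq: "cm a ?c \<otimes> cm b (z \<otimes> y) = cm b (y \<otimes> z)" by simp
  let ?p = "cm b y" and ?r = "cm b z" and ?t = "t b y z" and ?t' = "t b z y"
  have in_A: "?p \<in> A" "?r \<in> A" "?t \<in> A" "?t' \<in> A" "cm a ?c \<in> A" using a b y z by auto
  then have c: "?p \<in> carrier G" "?r \<in> carrier G" "?t \<in> carrier G" "?t' \<in> carrier G" "cm a ?c \<in> carrier G"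
    using Ac by blast+
  have "cm a ?c \<otimes> (?p \<otimes> ?r) \<otimes> ?t' = (?p \<otimes> ?r) \<otimes> ?t"
    using eq prod[OF b z y] prod[OF b y z] ab[OF in_A(1,2)] c by (simp add: t_def m_assoc)
  moreover have "(?p \<otimes> ?r) \<otimes> (cm a ?c \<otimes> ?t') = cm a ?c \<otimes> (?p \<otimes> ?r) \<otimes> ?t'"
    using ab[of "?p \<otimes> ?r" "cm a ?c"] in_A c by (simp flip: m_assoc) (use in_A in auto)
  ultimately have "(?p \<otimes> ?r) \<otimes> (cm a ?c \<otimes> ?t') = (?p \<otimes> ?r) \<otimes> ?t" by simp
  then have "cm a ?c \<otimes> ?t' = ?t" using c by simp
  moreover have "?t \<otimes> ?t = cm a ?c \<otimes> (?t' \<otimes> ?t)"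
    using calculation c by (simp flip: m_assoc)
  moreover have "?t' \<otimes> ?t = \<one>" using anti[OF b z y] by simp
  ultimately show ?T2 using tb c by (simp add: t_def)
qed

text \<open>The conjugates of an element commute, so every element lies in an abelian normal
  subgroup and \<open>two_Engel_action\<close> applies. Swapping two neighbouring entries inverts d
  = [x, y, z, w]; hence d = [z, w, x, y]. So [[x, y], [z, w]] and its inverse [[z, w], [x, y]] both
  equal d^2, which gives d^4 = 1, impossible in odd exponent unless d = 1.\<close>

lemma two_Engel_class_3:
  assumes E: "\<And>x y. x \<in> carrier G \<Longrightarrow> y \<in> carrier G \<Longrightarrow> cm (cm y x) x = \<one>"
    and n: "odd n" "\<And>x. x \<in> carrier G \<Longrightarrow> x [^] (n::nat) = \<one>"
    and c: "x \<in> carrier G" "y \<in> carrier G" "z \<in> carrier G" "w \<in> carrier G"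
  shows "cm (cm (cm x y) z) w = \<one>"
proof -
  have closure: "\<exists>A. A \<lhd> G \<and> x \<in> A \<and> (\<forall>a\<in>A. \<forall>b\<in>A. a \<otimes> b = b \<otimes> a)" if x: "x \<in> carrier G" for x
  proof -
    let ?Y = "{cj x g | g. g \<in> carrier G}"
    let ?A = "generate G ?Y"
    have Y: "?Y \<subseteq> carrier G" using x by auto
    note one = one_is_normal
    have 1: "cm p q \<in> {\<one>}" if pq: "p \<in> ?Y" "q \<in> ?Y" for p q
    proof -
      obtain g h where g: "g \<in> carrier G" "h \<in> carrier G" "p = cj x g" "q = cj x h" using pq by blast
      \<comment> \<open>After conjugation by g^-1 the pair becomes \<open>x\<close> and its
        conjugate x [x, k], and \<open>x\<close> commutes with [x, k] by the Engel
        condition.\<close>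
      let ?k = "h \<otimes> inv g"
      have "cm (cm ?k x) x = \<one>" using E x g by simp
      then have "cm (inv (cm ?k x)) x = \<one>"
        using x g by (simp add: commutator_inv_left)
      then have "cm (cm x ?k) x = \<one>" using x g by (simp add: inv_commutator)
      then have "cm x (cm x ?k) = \<one>"
        using x g inv_commutator[of "cm x ?k" x] by simp
      then have "cm x (cj x ?k) = \<one>"
        using x g by (simp add: conjugate_eq commutator_mult_right)
      then have "cj (cm x (cj x ?k)) g = \<one>" using g by simp
      then show ?thesis using x g by (simp add: conjugate_commutator conjugate_conjugate m_assoc)
    qed
    have 2: "cm p q \<in> {\<one>}" if "p \<in> ?A" "q \<in> ?Y" for p q
      using commutator_generate_left[OF one Y Y 1 that] by simp
    have 3: "cm p q \<in> {\<one>}" if "p \<in> ?A" "q \<in> ?A" for p q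
      using commutator_generate_right[OF one Y generate_incl[OF Y] 2 that(2,1)] by simp
    have "?A \<lhd> G"
    proof (rule normal_generateI[OF Y])
      fix h g assume "h \<in> ?Y" and g: "g \<in> carrier G"
      then obtain k where k: "k \<in> carrier G" "h = cj x k" by blast
      then have "g \<otimes> h \<otimes> inv g = cj x (k \<otimes> inv g)" using x g by (simp add: word_simps)
      then show "g \<otimes> h \<otimes> inv g \<in> ?Y" using k g by blast
    qed
    moreover have "cj x \<one> \<in> ?A" by (rule generate.incl) blast
    then have "x \<in> ?A" using x by simp
    moreover have "\<forall>a\<in>?A. \<forall>b\<in>?A. a \<otimes> b = b \<otimes> a"
      using 3 generate_in_carrier[OF Y] by (simp add: commutator_eq_one_iff)
    ultimately show ?thesis by blast
  qed
  have action: "cm (cm a y) z = inv (cm (cm a z) y)"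
    "cm a (cm y z) = cm (cm a y) z \<otimes> cm (cm a y) z"
    "cm (inv (cm a y)) z = inv (cm (cm a y) z)"
    if c: "a \<in> carrier G" "y \<in> carrier G" "z \<in> carrier G" for a y z
  proof -
    obtain A where A: "A \<lhd> G" "a \<in> A" and com: "\<And>a b. a \<in> A \<Longrightarrow> b \<in> A \<Longrightarrow> a \<otimes> b = b \<otimes> a"
      using closure[OF c(1)] by blast
    have A': "subgroup A G" using A(1) by (rule normal_imp_subgroup)
    have EA: "cm (cm a y) y = \<one>" if "a \<in> A" "y \<in> carrier G" for a y
      using E that subgroup.mem_carrier[OF A'] by blast
    show "cm (cm a y) z = inv (cm (cm a z) y)"
      "cm a (cm y z) = cm (cm a y) z \<otimes> cm (cm a y) z"
      using two_Engel_action[OF A(1) com EA A(2) c(2,3)] by blast+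
    have s: "cm a y \<in> A" "cm (cm a y) z \<in> A"
      using normal_commutator(1)[OF A(1)] A(2) c by auto
    then have "inv (cm (cm a y) z) \<otimes> inv (cm a y) = inv (cm a y) \<otimes> inv (cm (cm a y) z)"
      using com subgroup.m_inv_closed[OF A'] by blast
    then show "cm (inv (cm a y)) z = inv (cm (cm a y) z)"
      using c by (simp add: commutator_inv_left conjugate_commuting)
  qed
  let ?D = "\<lambda>x y z w. cm (cm (cm x y) z) w"
  have P1: "?D x y z w = inv (?D x z y w)"
    if "x \<in> carrier G" "y \<in> carrier G" "z \<in> carrier G" "w \<in> carrier G" for x y z w
    using that action(1)[of x y z] action(3)[of "cm x z" y w] by simp
  have P2: "?D x y z w = inv (?D x y w z)"
    if "x \<in> carrier G" "y \<in> carrier G" "z \<in> carrier G" "w \<in> carrier G" for x y z w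
    using that action(1)[of "cm x y" z w] by simp
  have P3: "?D x y z w = inv (?D y x z w)"
    if "x \<in> carrier G" "y \<in> carrier G" "z \<in> carrier G" "w \<in> carrier G" for x y z w
    using that action(3)[of y x z] action(3)[of "cm y x" z w] by (simp add: inv_commutator)
  have sym: "?D z w x y = ?D x y z w"
    using P1[of z w x y] P3[of z x w y] P2[of x z w y] P1[of x z y w] c by simp
  let ?d = "?D x y z w"
  have "cm (cm x y) (cm z w) = ?d \<otimes> ?d" "cm (cm z w) (cm x y) = ?d \<otimes> ?d"
    using action(2)[of "cm x y" z w] action(2)[of "cm z w" x y] c sym by simp_all
  then have "?d \<otimes> ?d \<otimes> (?d \<otimes> ?d) = \<one>"
    using inv_commutator[of "cm x y" "cm z w"] c by (metis commutator_closed r_inv)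
  then have "?d [^] (4::nat) = \<one>"
    using c by (simp add: numeral_eq_Suc m_assoc)
  moreover have "coprime 4 n"
    using n(1) coprime_power_left_iff[of 2 2 n] by (simp add: coprime_left_2_iff_odd)
  ultimately show ?thesis
    using n(2) c by (intro pow_coprime_eq_one[of ?d 4 n]) auto
qed

lemma pow_torsion_normal:
  assumes N: "N \<lhd> G" and ab: "\<And>a b. a \<in> N \<Longrightarrow> b \<in> N \<Longrightarrow> a \<otimes> b = b \<otimes> a"
  shows "{a \<in> N. a [^] (q::nat) = \<one>} \<lhd> G"
proof (rule normalI_conjugate)
  have N': "subgroup N G" using N by (rule normal_imp_subgroup)
  have Nc: "a \<in> N \<Longrightarrow> a \<in> carrier G" for a using N' by (rule subgroup.mem_carrier)
  show "subgroup {a \<in> N. a [^] q = \<one>} G"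
  proof (rule subgroupI)
    show "{a \<in> N. a [^] q = \<one>} \<noteq> {}" using subgroup.one_closed[OF N'] nat_pow_one by blast
  qed (use Nc subgroup.m_closed[OF N'] subgroup.m_inv_closed[OF N'] ab
      in \<open>auto simp: nat_pow_inv pow_mult_distrib\<close>)
  fix x y assume "x \<in> {a \<in> N. a [^] q = \<one>}" "y \<in> carrier G"
  then show "cj x y \<in> {a \<in> N. a [^] q = \<one>}"
    using Nc normal_conjugate[OF N] by (auto simp: conjugate_pow[symmetric])
qed

lemma lower_central_commute:
  assumes "lower_central G k = {\<one>}" "k \<le> Suc (i + j)" "a \<in> lower_central G i" "b \<in> lower_central G j"
  shows "a \<otimes> b = b \<otimes> a"
  using commutator_lower_central_lower_central[OF assms(3,4)] lower_central_antimono[OF assms(2)] assms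
    lower_central_carrier by (auto simp flip: commutator_eq_one_iff)

theorem three_group_class_5:
  assumes triv: "lower_central G 5 = {\<one>}"
    and q: "(q::nat) = 3 ^ k" and e: "\<And>x. x \<in> carrier G \<Longrightarrow> x [^] (3 * q) = \<one>"
  shows "\<And>x y. x \<in> carrier G \<Longrightarrow> y \<in> carrier G \<Longrightarrow> cm (cm y x) x [^] q = \<one>"
    and "\<And>w. w \<in> lower_central G 3 \<Longrightarrow> w [^] q = \<one>"
proof -
  \<comment> \<open>\<open>lower_central G 2\<close> is \<open>\<gamma>\<^sub>3\<close>, abelian
    since its commutators lie in \<open>\<gamma>\<^sub>6 = 1\<close>. Therefore the elements killed
    by \<open>q\<close> form a subgroup.\<close>
  define K where "K = {a \<in> lower_central G 2. a [^] q = \<one>}"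
  note bin = binomial_three_power[OF q HOL.refl]
  have K: "K \<lhd> G" unfolding K_def
    by (intro pow_torsion_normal normal_lower_central lower_central_commute[OF triv]) simp_all
  have lawK: "inv (cm y x \<otimes> cm y x \<otimes> cm y x) \<otimes> cj (cm y x \<otimes> cj (cm y x) x) y \<otimes> cm y x \<in> K"
    if x: "x \<in> carrier G" and y: "y \<in> carrier G" for x y
  proof -
    let ?u = "cm y x"
    let ?d = "inv (?u \<otimes> ?u \<otimes> ?u) \<otimes> cj (?u \<otimes> cj ?u x) y \<otimes> ?u"
    have d: "?d \<in> carrier G" using x y by simp
    obtain c4 c5 where
      HP: "\<forall>n. (x \<otimes> y) [^] (n::nat) = x [^] n \<otimes> y [^] n \<otimes> (cj ?u y [^] (n choose 2)
       \<otimes> cj ?d y [^] (n choose 3) \<otimes> c4 [^] (n choose 4) \<otimes> c5 [^] (n choose 5))"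
      and c: "cj ?d y \<in> lower_central G 2" "c4 \<in> lower_central G 3" "c5 \<in> lower_central G 4"
      using Hall_Petrescu_5[OF triv x y normal_self] by metis
    have "cj ?u y [^] ((3 * q) choose 2) = \<one>" "c4 [^] ((3 * q) choose 4) = \<one>" "c5 [^] ((3 * q) choose 5) = \<one>"
      using x y c(2,3) lower_central_carrier
      by (simp_all add: pow_eq_one_dvd[OF _ e bin(1)] pow_eq_one_dvd[OF _ e bin(2)] pow_eq_one_dvd[OF _ e bin(3)])
    then have "cj ?d y [^] ((3 * q) choose 3) = \<one>"
      using HP[rule_format, of "3 * q"] e x y d by simp
    \<comment> \<open>Only the weight 3 factor survives in the formula. Its power \<open>q\<close>
      is killed by a number prime to 3, and by 3 since \<open>3 * q\<close> annihilates the
      group.\<close>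
    then have 1: "(cj ?d y [^] q) [^] ((3 * q - 1) choose 2) = \<one>"
      using d y bin(4) by (simp add: nat_pow_pow)
    have 2: "(cj ?d y [^] q) [^] (3::nat) = \<one>"
      using e[of "cj ?d y"] d y by (simp add: nat_pow_pow mult.commute)
    have "cj ?d y [^] q = \<one>"
      by (rule pow_coprime_eq_one[OF nat_pow_closed[OF conjugate_closed[OF d y]] 1 2 bin(5)])
    then have "cj ?d y \<in> K" using c(1) by (simp add: K_def)
    then show ?thesis using d y by (simp add: normal_conjugate_iff[OF K])
  qed
  define T where "T = G Mod K"
  define h where "h a = K #> a" for a
  have "group T" unfolding T_def using K by (rule normal.factorgroup_is_group)
  moreover have "h \<in> hom G T"
    unfolding T_def h_def using normal.r_coset_hom_Mod[OF K] by (simp add: hom_def)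
  ultimately interpret h: group_hom G T h by (intro group_hom.intro group_hom_axioms.intro group_axioms)
  have h_one: "h a = \<one>\<^bsub>T\<^esub> \<longleftrightarrow> a \<in> K" if "a \<in> carrier G" for a
    using that normal_imp_subgroup[OF K] unfolding h_def T_def
    by (metis coset_join1 coset_join2 one_FactGroup subgroup.subset)
  have rep: "\<exists>a\<in>carrier G. x = h a" if "x \<in> carrier T" for x
    using that by (auto simp: T_def h_def carrier_FactGroup)
  have h_cm: "h (cm a b) = commutator T (h a) (h b)"
    if "a \<in> carrier G" "b \<in> carrier G" for a b
    using that by (simp add: commutator_def)
  have h_cj: "h (cj a b) = conjugate T (h a) (h b)"
    if "a \<in> carrier G" "b \<in> carrier G" for a b
    using that by (simp add: conjugate_def)
  have lawT: "h.H.cj (h.H.cm y x \<otimes>\<^bsub>T\<^esub> h.H.cj (h.H.cm y x) x) y = h.H.cm y x \<otimes>\<^bsub>T\<^esub> h.H.cm y x"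
    if xy: "x \<in> carrier T" "y \<in> carrier T" for x y
  proof -
    obtain a where a: "a \<in> carrier G" "x = h a" using rep xy(1) by blast
    obtain b where b: "b \<in> carrier G" "y = h b" using rep xy(2) by blast
    let ?u = "h.H.cm y x"
    let ?w = "h.H.cj (?u \<otimes>\<^bsub>T\<^esub> h.H.cj ?u x) y"
    have c: "?u \<in> carrier T" "?w \<in> carrier T" using xy by simp_all
    have "h (inv (cm b a \<otimes> cm b a \<otimes> cm b a) \<otimes> cj (cm b a \<otimes> cj (cm b a) a) b \<otimes> cm b a) = \<one>\<^bsub>T\<^esub>"
      using lawK[OF a(1) b(1)] a(1) b(1) by (subst h_one) simp_all
    then have "inv\<^bsub>T\<^esub> (?u \<otimes>\<^bsub>T\<^esub> ?u \<otimes>\<^bsub>T\<^esub> ?u) \<otimes>\<^bsub>T\<^esub> ?w \<otimes>\<^bsub>T\<^esub> ?u = \<one>\<^bsub>T\<^esub>"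
      using a b by (simp add: h_cm h_cj)
    then have "?w \<otimes>\<^bsub>T\<^esub> ?u = (?u \<otimes>\<^bsub>T\<^esub> ?u) \<otimes>\<^bsub>T\<^esub> ?u"
      using c by (simp add: h.H.m_assoc h.H.inv_solve_left')
    then show ?thesis using c by simp
  qed
  have odd: "odd (3 * q)" using q by simp
  have eT: "x [^]\<^bsub>T\<^esub> (3 * q) = \<one>\<^bsub>T\<^esub>" if x: "x \<in> carrier T" for x
  proof -
    obtain a where "a \<in> carrier G" "x = h a" using rep x by blast
    then show ?thesis using e[of a] h.hom_nat_pow[of a "3 * q"] by simp
  qed
  note Engel = h.H.two_Engel_of_law[OF lawT odd eT]
  have 1: "cm (cm y x) x \<in> K" if "x \<in> carrier G" "y \<in> carrier G" for x y
    using that Engel[of "h x" "h y"] by (simp add: h_cm flip: h_one)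
  then show "cm (cm y x) x [^] q = \<one>" if "x \<in> carrier G" "y \<in> carrier G" for x y
    using that by (simp add: K_def)
  have 2: "cm (cm (cm x y) z) w \<in> K"
    if "x \<in> carrier G" "y \<in> carrier G" "z \<in> carrier G" "w \<in> carrier G" for x y z w
    using that h.H.two_Engel_class_3[OF Engel odd eT, of "h x" "h y" "h z" "h w"]
    by (simp add: h_cm flip: h_one)
  \<comment> \<open>The statement \<open>2\<close> puts each [x, y] into the preimage of the second
    center of G/K. From there \<open>\<gamma>\<^sub>3\<close> falls into the preimage of the center
    and \<open>\<gamma>\<^sub>4\<close> into \<open>K\<close>.\<close>
  have "lower_central G (Suc 0) \<subseteq> centralizer_mod G (centralizer_mod G K (carrier G)) (carrier G)"
    using 2 by (intro lower_central_SucI normal_centralizer_mod K) (auto simp: centralizer_mod_def)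
  then have "lower_central G (Suc (Suc 0)) \<subseteq> centralizer_mod G K (carrier G)"
    by (intro lower_central_SucI normal_centralizer_mod K) (auto simp: centralizer_mod_def)
  then have "lower_central G (Suc (Suc (Suc 0))) \<subseteq> K"
    by (intro lower_central_SucI K) (auto simp: centralizer_mod_def)
  then show "w [^] q = \<one>" if "w \<in> lower_central G 3" for w
    using that by (auto simp: K_def numeral_3_eq_3)
qed

end

section \<open>The exterior square as a crossed module\<close>

text \<open>An interface that hides the presentation. The values of \<open>act\<close> and
  \<open>d\<close> are prescribed on wedges only; that \<open>act\<close> is a group action, and the
  Peiffer identity making this a crossed module, are derived because wedges generate.\<close>

locale exterior_pairing = G: group G + M: group M
  for G :: "('a, 'm) monoid_scheme" and M :: "('b, 'n) monoid_scheme" +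
  fixes w :: "'a \<Rightarrow> 'a \<Rightarrow> 'b" and act :: "'b \<Rightarrow> 'a \<Rightarrow> 'b" and d :: "'b \<Rightarrow> 'a"
  assumes w_closed [simp, intro]: "g \<in> carrier G \<Longrightarrow> h \<in> carrier G \<Longrightarrow> w g h \<in> carrier M"
    and generated: "carrier M = generate M {w g h | g h. g \<in> carrier G \<and> h \<in> carrier G}"
    and w_conj_mult_left: "g \<in> carrier G \<Longrightarrow> h \<in> carrier G \<Longrightarrow> k \<in> carrier G \<Longrightarrow>
      w (g \<otimes>\<^bsub>G\<^esub> h) k = w (G.cj g h) (G.cj k h) \<otimes>\<^bsub>M\<^esub> w h k"
    and w_conj_mult_right: "g \<in> carrier G \<Longrightarrow> h \<in> carrier G \<Longrightarrow> k \<in> carrier G \<Longrightarrow>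
      w g (h \<otimes>\<^bsub>G\<^esub> k) = w g k \<otimes>\<^bsub>M\<^esub> w (G.cj g k) (G.cj h k)"
    and w_self: "g \<in> carrier G \<Longrightarrow> w g g = \<one>\<^bsub>M\<^esub>"
    and act_hom: "k \<in> carrier G \<Longrightarrow> (\<lambda>m. act m k) \<in> hom M M"
    and act_w: "g \<in> carrier G \<Longrightarrow> h \<in> carrier G \<Longrightarrow> k \<in> carrier G \<Longrightarrow>
      act (w g h) k = w (G.cj g k) (G.cj h k)"
    and d_hom: "d \<in> hom M G"
    and d_w: "g \<in> carrier G \<Longrightarrow> h \<in> carrier G \<Longrightarrow> d (w g h) = G.cm g h"
begin

sublocale d: group_hom M G d
  using d_hom by unfold_locales

lemma act_group_hom: "k \<in> carrier G \<Longrightarrow> group_hom M M (\<lambda>m. act m k)"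
  using act_hom by unfold_locales

lemma act_closed [simp, intro]: "m \<in> carrier M \<Longrightarrow> k \<in> carrier G \<Longrightarrow> act m k \<in> carrier M"
  using group_hom.hom_closed[OF act_group_hom] .

lemma act_mult:
  "m \<in> carrier M \<Longrightarrow> n \<in> carrier M \<Longrightarrow> k \<in> carrier G \<Longrightarrow>
    act (m \<otimes>\<^bsub>M\<^esub> n) k = act m k \<otimes>\<^bsub>M\<^esub> act n k"
  using group_hom.hom_mult[OF act_group_hom] .

lemma act_inv: "m \<in> carrier M \<Longrightarrow> k \<in> carrier G \<Longrightarrow> act (inv\<^bsub>M\<^esub> m) k = inv\<^bsub>M\<^esub> act m k"
  using group_hom.hom_inv[OF act_group_hom] .

lemma act_one [simp]: "k \<in> carrier G \<Longrightarrow> act \<one>\<^bsub>M\<^esub> k = \<one>\<^bsub>M\<^esub>"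
  using group_hom.hom_one[OF act_group_hom] .

lemma hom_eqI:
  assumes "group H" "f \<in> hom M H" "f' \<in> hom M H"
    and eq: "\<And>g h. g \<in> carrier G \<Longrightarrow> h \<in> carrier G \<Longrightarrow> f (w g h) = f' (w g h)"
    and "m \<in> carrier M"
  shows "f m = f' m"
proof -
  interpret f: group_hom M H f using assms by (intro group_hom.intro group_hom_axioms.intro M.group_axioms)
  interpret f': group_hom M H f' using assms by (intro group_hom.intro group_hom_axioms.intro M.group_axioms)
  have "m \<in> generate M {w g h | g h. g \<in> carrier G \<and> h \<in> carrier G}"
    using assms(5) generated by simp
  then have "m \<in> carrier M \<and> f m = f' m"
    by (induction rule: generate.induct) (auto simp: eq)
  then show ?thesis by simp
qed

lemma act_act:
  assumes "m \<in> carrier M" "g \<in> carrier G" "h \<in> carrier G"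
  shows "act (act m g) h = act m (g \<otimes>\<^bsub>G\<^esub> h)"
proof -
  have "(\<lambda>m. act (act m g) h) \<in> hom M M"
    using assms by (auto intro!: homI simp: act_mult)
  from hom_eqI[OF M.group_axioms this act_hom] show ?thesis
    using assms by (simp add: act_w G.conjugate_conjugate)
qed

lemma act_group_one [simp]:
  assumes "m \<in> carrier M" shows "act m \<one>\<^bsub>G\<^esub> = m"
proof -
  have "(\<lambda>m. m) \<in> hom M M" by (simp add: hom_def)
  from hom_eqI[OF M.group_axioms act_hom this] show ?thesis
    using assms by (simp add: act_w)
qed

lemma act_inv_act [simp]:
  "m \<in> carrier M \<Longrightarrow> g \<in> carrier G \<Longrightarrow> act (act m g) (inv\<^bsub>G\<^esub> g) = m"
  "m \<in> carrier M \<Longrightarrow> g \<in> carrier G \<Longrightarrow> act (act m (inv\<^bsub>G\<^esub> g)) g = m"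
  by (simp_all add: act_act)

lemma w_mult_left:
  "g \<in> carrier G \<Longrightarrow> h \<in> carrier G \<Longrightarrow> k \<in> carrier G \<Longrightarrow>
    w (g \<otimes>\<^bsub>G\<^esub> h) k = act (w g k) h \<otimes>\<^bsub>M\<^esub> w h k"
  by (simp add: w_conj_mult_left act_w)

lemma w_mult_right:
  "g \<in> carrier G \<Longrightarrow> h \<in> carrier G \<Longrightarrow> k \<in> carrier G \<Longrightarrow>
    w g (h \<otimes>\<^bsub>G\<^esub> k) = w g k \<otimes>\<^bsub>M\<^esub> act (w g h) k"
  by (simp add: w_conj_mult_right act_w)

lemma w_one_left [simp]:
  assumes "k \<in> carrier G" shows "w \<one>\<^bsub>G\<^esub> k = \<one>\<^bsub>M\<^esub>"
  using w_mult_left[of "\<one>\<^bsub>G\<^esub>" "\<one>\<^bsub>G\<^esub>" k] assms by simp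

text \<open>Expanding the trivial wedge of g h with itself by both product rules leaves (g \<and>
  h)(h \<and> g), conjugated by \<open>h\<close>.\<close>

lemma w_swap:
  assumes "g \<in> carrier G" "h \<in> carrier G"
  shows "w g h = inv\<^bsub>M\<^esub> (w h g)"
proof -
  have *: "\<one>\<^bsub>M\<^esub> = act (w g h \<otimes>\<^bsub>M\<^esub> w h g) h"
    using assms by (subst w_self[of "g \<otimes>\<^bsub>G\<^esub> h", symmetric])
      (simp_all add: w_mult_left w_mult_right w_self[OF assms(1)] w_self[OF assms(2)] act_mult)
  have "w g h \<otimes>\<^bsub>M\<^esub> w h g = act (act (w g h \<otimes>\<^bsub>M\<^esub> w h g) h) (inv\<^bsub>G\<^esub> h)"
    using assms by simp
  also have "\<dots> = \<one>\<^bsub>M\<^esub>" using assms by (simp flip: *)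
  finally have "w g h \<otimes>\<^bsub>M\<^esub> w h g = \<one>\<^bsub>M\<^esub>" .
  then show ?thesis using assms by (simp add: M.inv_equality)
qed

text \<open>Expanding \<open>g g' \<and> h h'\<close> by the two product rules in either order.\<close>

lemma w_exchange:
  assumes "g \<in> carrier G" "h \<in> carrier G" "g' \<in> carrier G" "h' \<in> carrier G"
  shows "act (w g h) (h' \<otimes>\<^bsub>G\<^esub> g') \<otimes>\<^bsub>M\<^esub> w g' h' = w g' h' \<otimes>\<^bsub>M\<^esub> act (w g h) (g' \<otimes>\<^bsub>G\<^esub> h')"
proof -
  let ?p = "act (w g h') g'" and ?r = "act (w g' h) h'"
  have "w (g \<otimes>\<^bsub>G\<^esub> g') (h \<otimes>\<^bsub>G\<^esub> h') =
      ?p \<otimes>\<^bsub>M\<^esub> (act (w g h) (h' \<otimes>\<^bsub>G\<^esub> g') \<otimes>\<^bsub>M\<^esub> w g' h') \<otimes>\<^bsub>M\<^esub> ?r"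
    using assms by (subst w_mult_left) (simp_all add: w_mult_right act_mult act_act M.m_assoc)
  moreover have "w (g \<otimes>\<^bsub>G\<^esub> g') (h \<otimes>\<^bsub>G\<^esub> h') =
      ?p \<otimes>\<^bsub>M\<^esub> (w g' h' \<otimes>\<^bsub>M\<^esub> act (w g h) (g' \<otimes>\<^bsub>G\<^esub> h')) \<otimes>\<^bsub>M\<^esub> ?r"
    using assms by (subst w_mult_right) (simp_all add: w_mult_left act_mult act_act M.m_assoc)
  ultimately show ?thesis using assms by simp
qed

text \<open>By \<open>w_exchange\<close>, conjugation by g \<and> h turns the action of h g into the
  action of g h, first on wedges and then everywhere. Undoing the action of h g leaves that of
  [g, h].\<close>

lemma Peiffer_w:
  assumes "m \<in> carrier M" "g \<in> carrier G" "h \<in> carrier G"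
  shows "act m (G.cm g h) = M.cj m (w g h)"
proof -
  let ?k = "h \<otimes>\<^bsub>G\<^esub> g"
  have 1: "(\<lambda>m. M.cj (act m ?k) (w g h)) \<in> hom M M"
    using assms by (auto intro!: homI simp: act_mult M.conjugate_mult)
  have 2: "(\<lambda>m. act m (g \<otimes>\<^bsub>G\<^esub> h)) \<in> hom M M"
    using assms by (intro act_hom) simp
  have 3: "M.cj (act (w g' h') ?k) (w g h) = act (w g' h') (g \<otimes>\<^bsub>G\<^esub> h)"
    if gh': "g' \<in> carrier G" "h' \<in> carrier G" for g' h'
  proof -
    have "M.cj (act (w g' h') ?k) (w g h) = inv\<^bsub>M\<^esub> (w g h) \<otimes>\<^bsub>M\<^esub> (act (w g' h') ?k \<otimes>\<^bsub>M\<^esub> w g h)"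
      using gh' assms by (simp add: conjugate_def M.m_assoc)
    also have "\<dots> = act (w g' h') (g \<otimes>\<^bsub>G\<^esub> h)"
      unfolding w_exchange[OF gh' assms(2,3)] using gh' assms by (simp add: M.inv_cancel_left)
    finally show ?thesis .
  qed
  have "M.cj (act (act m (inv\<^bsub>G\<^esub> ?k)) ?k) (w g h) = act (act m (inv\<^bsub>G\<^esub> ?k)) (g \<otimes>\<^bsub>G\<^esub> h)"
    using hom_eqI[OF M.group_axioms 1 2 3, of "act m (inv\<^bsub>G\<^esub> ?k)"] assms by simp
  moreover have "inv\<^bsub>G\<^esub> ?k \<otimes>\<^bsub>G\<^esub> (g \<otimes>\<^bsub>G\<^esub> h) = G.cm g h"
    using assms by (simp add: G.word_simps)
  ultimately show ?thesis using assms by (simp add: act_act)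
qed

lemma Peiffer:
  assumes "m \<in> carrier M" "n \<in> carrier M"
  shows "act m (d n) = M.cj m n"
proof -
  have "n \<in> generate M {w g h | g h. g \<in> carrier G \<and> h \<in> carrier G}"
    using assms(2) generated by simp
  then have "n \<in> carrier M \<and> (\<forall>m\<in>carrier M. act m (d n) = M.cj m n)"
  proof (induction rule: generate.induct)
    case (incl n)
    then show ?case by (auto simp: Peiffer_w d_w)
  next
    case (inv n)
    have n: "n \<in> carrier M" "\<And>m. m \<in> carrier M \<Longrightarrow> act m (d n) = M.cj m n"
      using inv by (auto simp: Peiffer_w d_w)
    have "act m (inv\<^bsub>G\<^esub> (d n)) = M.cj m (inv\<^bsub>M\<^esub> n)" if m: "m \<in> carrier M" for m
    proof -
      have "act (M.cj m (inv\<^bsub>M\<^esub> n)) (d n) = m"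
        using n m by (simp add: M.conjugate_conjugate)
      then show ?thesis using act_inv_act(1)[of "M.cj m (inv\<^bsub>M\<^esub> n)" "d n"] n m by simp
    qed
    then show ?case using n by simp
  next
    case (eng n n')
    then show ?case by (auto simp: M.conjugate_conjugate simp flip: act_act)
  qed simp
  with assms show ?thesis by blast
qed

lemma w_inv_left:
  assumes "x \<in> carrier G" "k \<in> carrier G"
  shows "w (inv\<^bsub>G\<^esub> x) k = act (inv\<^bsub>M\<^esub> (w x k)) (inv\<^bsub>G\<^esub> x)"
proof -
  have "act (w (inv\<^bsub>G\<^esub> x) k) x \<otimes>\<^bsub>M\<^esub> w x k = \<one>\<^bsub>M\<^esub>"
    using w_mult_left[of "inv\<^bsub>G\<^esub> x" x k] assms by simp
  then have "inv\<^bsub>M\<^esub> (w x k) = act (w (inv\<^bsub>G\<^esub> x) k) x"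
    using assms by (simp add: M.inv_equality)
  then show ?thesis using assms by simp
qed

text \<open>The element h k is also k^(h^-1) h, so g \<and> h k has two expansions. The second
  contains g^h \<and> k with g^h = g [g, h], and the common factor g \<and> k cancels with the help
  of \<open>Peiffer_w\<close>.\<close>

lemma w_commutator:
  assumes "g \<in> carrier G" "h \<in> carrier G" "k \<in> carrier G"
  shows "act (w g h) k = w g h \<otimes>\<^bsub>M\<^esub> w (G.cm g h) k"
proof -
  have "w (G.cj g h) k = M.cj (w g k) (w g h) \<otimes>\<^bsub>M\<^esub> w (G.cm g h) k"
    using w_mult_left[of g "G.cm g h" k] assms by (simp add: G.conjugate_eq Peiffer_w)
  moreover have "w g k \<otimes>\<^bsub>M\<^esub> act (w g h) k = w g h \<otimes>\<^bsub>M\<^esub> w (G.cj g h) k"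
  proof -
    have "h \<otimes>\<^bsub>G\<^esub> k = G.cj k (inv\<^bsub>G\<^esub> h) \<otimes>\<^bsub>G\<^esub> h" using assms by (simp add: G.word_simps)
    then have "w g k \<otimes>\<^bsub>M\<^esub> act (w g h) k = w g (G.cj k (inv\<^bsub>G\<^esub> h) \<otimes>\<^bsub>G\<^esub> h)"
      using assms by (simp flip: w_mult_right)
    also have "\<dots> = w g h \<otimes>\<^bsub>M\<^esub> w (G.cj g h) k"
      using assms by (subst w_mult_right) (simp_all add: act_w G.conjugate_conjugate)
    finally show ?thesis .
  qed
  ultimately have "w g k \<otimes>\<^bsub>M\<^esub> act (w g h) k = w g k \<otimes>\<^bsub>M\<^esub> (w g h \<otimes>\<^bsub>M\<^esub> w (G.cm g h) k)"
    using assms by (simp add: conjugate_def M.m_assoc M.inv_cancel_left)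
  then show ?thesis using assms by simp
qed

text \<open>Extends \<open>w_commutator\<close> from wedges to products by the Peiffer identity. It
  makes every commutator of \<open>M\<close> with \<open>G\<close> in the semidirect product a
  single wedge.\<close>

lemma act_eq:
  assumes "m \<in> carrier M" "k \<in> carrier G"
  shows "act m k = m \<otimes>\<^bsub>M\<^esub> w (d m) k"
proof -
  have "m \<in> generate M {w g h | g h. g \<in> carrier G \<and> h \<in> carrier G}"
    using assms(1) generated by simp
  then have "m \<in> carrier M \<and> act m k = m \<otimes>\<^bsub>M\<^esub> w (d m) k"
  proof (induction rule: generate.induct)
    case (incl m)
    then show ?case using assms(2) w_commutator d_w by auto
  next
    case (inv m)
    then have m: "m \<in> carrier M" "act m k = m \<otimes>\<^bsub>M\<^esub> w (d m) k"
      using assms(2) w_commutator d_w by auto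
    have "w (d (inv\<^bsub>M\<^esub> m)) k = M.cj (inv\<^bsub>M\<^esub> (w (d m) k)) (inv\<^bsub>M\<^esub> m)"
      using m assms(2) by (simp add: w_inv_left flip: Peiffer)
    then show ?case using m assms(2) by (simp add: act_inv M.word_simps)
  next
    case (eng m n)
    then show ?case
      using assms(2) by (simp add: act_mult w_mult_left Peiffer M.word_simps)
  qed (use assms in auto)
  then show ?thesis by simp
qed

end

theorem exterior_pairing_exterior_square:
  fixes G :: "('a, 'm) monoid_scheme"
  assumes "group G"
  shows "\<exists>w act d. exterior_pairing G (exterior_square G) w act d"
proof -
  interpret G: group G by fact
  let ?S = "carrier G \<times> carrier G" and ?R = "wedge_relations G"
  let ?M = "exterior_square G"
  have M: "group ?M" unfolding exterior_square_def by (rule group_presented_group)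
  interpret M: group ?M by fact
  let ?c = "\<lambda>u. pres_rel ?S ?R `` {u}"
  define w where "w g h = ?c [(True, (g, h))]" for g h
  have car: "u \<in> words ?S \<Longrightarrow> ?c u \<in> carrier ?M" for u
    by (auto simp: exterior_square_def carrier_presented_group)
  have mult: "u \<in> words ?S \<Longrightarrow> v \<in> words ?S \<Longrightarrow> ?c u \<otimes>\<^bsub>?M\<^esub> ?c v = ?c (u @ v)" for u v
    unfolding exterior_square_def by (rule mult_presented_group)
  have one: "\<one>\<^bsub>?M\<^esub> = ?c []" unfolding exterior_square_def by (rule one_presented_group)
  have eqI: "?c u = ?c v" if "pres_cong ?S ?R u v" for u v
    using that pres_cong_words[OF that] pres_rel_class_eq_iff by blast
  have w_closed: "w g h \<in> carrier ?M" if "g \<in> carrier G" "h \<in> carrier G" for g h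
    using that by (auto simp: w_def intro!: car)
  have wl: "w (g \<otimes>\<^bsub>G\<^esub> h) k = w (G.cj g h) (G.cj k h) \<otimes>\<^bsub>?M\<^esub> w h k"
    if "g \<in> carrier G" "h \<in> carrier G" "k \<in> carrier G" for g h k
  proof -
    have "w (g \<otimes>\<^bsub>G\<^esub> h) k = ?c [(True, (G.cj g h, G.cj k h)), (True, (h, k))]"
      unfolding w_def by (rule eqI, rule pres_cong.rel) (use that in \<open>auto simp: wedge_relations_def\<close>)
    then show ?thesis using that by (simp add: w_def mult)
  qed
  have wr: "w g (h \<otimes>\<^bsub>G\<^esub> k) = w g k \<otimes>\<^bsub>?M\<^esub> w (G.cj g k) (G.cj h k)"
    if "g \<in> carrier G" "h \<in> carrier G" "k \<in> carrier G" for g h k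
  proof -
    have "w g (h \<otimes>\<^bsub>G\<^esub> k) = ?c [(True, (g, k)), (True, (G.cj g k, G.cj h k))]"
      unfolding w_def by (rule eqI, rule pres_cong.rel) (use that in \<open>auto simp: wedge_relations_def\<close>)
    then show ?thesis using that by (simp add: w_def mult)
  qed
  have ws: "w g g = \<one>\<^bsub>?M\<^esub>" if "g \<in> carrier G" for g
    unfolding w_def one by (rule eqI, rule pres_cong.rel) (use that in \<open>auto simp: wedge_relations_def\<close>)
  have inv_w: "?c [(False, (g, h))] = inv\<^bsub>?M\<^esub> (w g h)" if "g \<in> carrier G" "h \<in> carrier G" for g h
  proof -
    have "pres_cong ?S ?R [(False, (g, h)), (True, (g, h))] []"
      using pres_cong.cancel[of "(g, h)" ?S ?R False] that by simp
    then have "?c [(False, (g, h))] \<otimes>\<^bsub>?M\<^esub> w g h = \<one>\<^bsub>?M\<^esub>"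
      using that eqI by (simp add: w_def mult one)
    then show ?thesis using that w_closed by (intro M.inv_equality[symmetric] car) auto
  qed
  let ?W = "{w g h | g h. g \<in> carrier G \<and> h \<in> carrier G}"
  have W: "?W \<subseteq> carrier ?M" using w_closed by auto
  have gen: "carrier ?M = generate ?M ?W"
  proof
    show "generate ?M ?W \<subseteq> carrier ?M" by (rule M.generate_incl[OF W])
    have "?c u \<in> generate ?M ?W" if "u \<in> words ?S" for u
      using that
    proof (induction u)
      case Nil
      show ?case using generate.one[of ?M ?W] by (simp add: one)
    next
      case (Cons x u)
      obtain b g h where x: "x = (b, (g, h))" by (metis prod.exhaust)
      have gh: "g \<in> carrier G" "h \<in> carrier G" and u: "u \<in> words ?S" using Cons.prems x by auto
      have "?c [x] \<in> generate ?M ?W"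
      proof (cases b)
        case True
        then show ?thesis using gh x by (auto simp flip: w_def intro!: generate.incl)
      next
        case False
        then show ?thesis using gh x inv_w by (auto intro!: generate.inv)
      qed
      moreover have "?c (x # u) = ?c [x] \<otimes>\<^bsub>?M\<^esub> ?c u" using u gh x by (simp add: mult)
      ultimately show ?case using Cons.IH[OF u] by (simp add: generate.eng)
    qed
    then show "carrier ?M \<subseteq> generate ?M ?W"
      by (auto simp: exterior_square_def carrier_presented_group)
  qed
  \<comment> \<open>The target \<open>H\<close> is left general: it is the exterior square itself
    for the action and \<open>G\<close> for the boundary. In the latter case the defining relations
    are the usual commutator identities.\<close>
  have extend: "\<exists>f\<in>hom ?M H. \<forall>g\<in>carrier G. \<forall>h\<in>carrier G. f (w g h) = p g h"
    if H: "group H" and p: "\<And>g h. g \<in> carrier G \<Longrightarrow> h \<in> carrier G \<Longrightarrow> p g h \<in> carrier H"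
      and pl: "\<And>g h k. g \<in> carrier G \<Longrightarrow> h \<in> carrier G \<Longrightarrow> k \<in> carrier G \<Longrightarrow>
        p (g \<otimes>\<^bsub>G\<^esub> h) k = p (G.cj g h) (G.cj k h) \<otimes>\<^bsub>H\<^esub> p h k"
      and pr: "\<And>g h k. g \<in> carrier G \<Longrightarrow> h \<in> carrier G \<Longrightarrow> k \<in> carrier G \<Longrightarrow>
        p g (h \<otimes>\<^bsub>G\<^esub> k) = p g k \<otimes>\<^bsub>H\<^esub> p (G.cj g k) (G.cj h k)"
      and ps: "\<And>g. g \<in> carrier G \<Longrightarrow> p g g = \<one>\<^bsub>H\<^esub>"
    for H :: "('c, 'k) monoid_scheme" and p
  proof -
    interpret H: group H by fact
    obtain f where f: "f \<in> hom (presented_group ?S ?R) H"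
      "\<And>u. u \<in> words ?S \<Longrightarrow> f (pres_rel ?S ?R `` {u}) = eval_word H (case_prod p) u"
    proof (rule presented_group_hom[OF H, of ?S "case_prod p" ?R])
      fix u v assume "(u, v) \<in> ?R"
      then show "eval_word H (case_prod p) u = eval_word H (case_prod p) v"
        using p pl pr ps by (auto simp: wedge_relations_def eval_word_def eval_letter_def)
    qed (use p in auto)
    have "f (w g h) = p g h" if "g \<in> carrier G" "h \<in> carrier G" for g h
      using that p by (simp add: w_def f(2) eval_word_def eval_letter_def)
    with f(1) show ?thesis unfolding exterior_square_def by blast
  qed
  have "\<exists>f\<in>hom ?M ?M. \<forall>g\<in>carrier G. \<forall>h\<in>carrier G. f (w g h) = w (G.cj g k) (G.cj h k)"
    if k: "k \<in> carrier G" for k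
  proof (rule extend[OF M])
    fix g h l assume "g \<in> carrier G" "h \<in> carrier G" "l \<in> carrier G"
    moreover have "G.cj (G.cj a b) k = G.cj (G.cj a k) (G.cj b k)"
      if "a \<in> carrier G" "b \<in> carrier G" for a b using that k by (simp add: G.word_simps)
    ultimately show "w (G.cj (g \<otimes>\<^bsub>G\<^esub> h) k) (G.cj l k) =
        w (G.cj (G.cj g h) k) (G.cj (G.cj l h) k) \<otimes>\<^bsub>?M\<^esub> w (G.cj h k) (G.cj l k)"
      "w (G.cj g k) (G.cj (h \<otimes>\<^bsub>G\<^esub> l) k) =
        w (G.cj g k) (G.cj l k) \<otimes>\<^bsub>?M\<^esub> w (G.cj (G.cj g l) k) (G.cj (G.cj h l) k)"
      using k by (simp_all add: wl wr G.conjugate_mult)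
  qed (use k w_closed ws in auto)
  then obtain f where f: "\<And>k. k \<in> carrier G \<Longrightarrow> f k \<in> hom ?M ?M"
    "\<And>g h k. g \<in> carrier G \<Longrightarrow> h \<in> carrier G \<Longrightarrow> k \<in> carrier G \<Longrightarrow> f k (w g h) = w (G.cj g k) (G.cj h k)"
    by metis
  obtain d where d: "d \<in> hom ?M G" "\<And>g h. g \<in> carrier G \<Longrightarrow> h \<in> carrier G \<Longrightarrow> d (w g h) = G.cm g h"
  proof -
    have "\<exists>f\<in>hom ?M G. \<forall>g\<in>carrier G. \<forall>h\<in>carrier G. f (w g h) = G.cm g h"
      by (rule extend[OF G.group_axioms])
        (simp_all add: G.commutator_mult_left G.commutator_mult_right G.conjugate_commutator)
    then show ?thesis using that by blast
  qed
  have "exterior_pairing G ?M w (\<lambda>m k. f k m) d"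
    by unfold_locales (use w_closed gen wl wr ws f d in auto)
  then show ?thesis by blast
qed

section \<open>The semidirect product of the group and its exterior square\<close>

context exterior_pairing
begin

text \<open>The pair (g, m) stands for the product g m, and the multiplication encodes m h = h
  m^h.\<close>

definition semidirect :: "('a \<times> 'b) monoid" where
  "semidirect = \<lparr>carrier = carrier G \<times> carrier M,
     monoid.mult = (\<lambda>(g, m) (h, n). (g \<otimes>\<^bsub>G\<^esub> h, act m h \<otimes>\<^bsub>M\<^esub> n)), one = (\<one>\<^bsub>G\<^esub>, \<one>\<^bsub>M\<^esub>)\<rparr>"

definition inG :: "'a \<Rightarrow> 'a \<times> 'b" where "inG g = (g, \<one>\<^bsub>M\<^esub>)"

definition inM :: "'b \<Rightarrow> 'a \<times> 'b" where "inM m = (\<one>\<^bsub>G\<^esub>, m)"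

lemma group_semidirect: "group semidirect"
proof (rule groupI)
  fix x assume "x \<in> carrier semidirect"
  then show "\<exists>y\<in>carrier semidirect. y \<otimes>\<^bsub>semidirect\<^esub> x = \<one>\<^bsub>semidirect\<^esub>"
    by (intro bexI[of _ "(inv\<^bsub>G\<^esub> (fst x), inv\<^bsub>M\<^esub> (act (snd x) (inv\<^bsub>G\<^esub> (fst x))))"])
      (auto simp: semidirect_def act_inv)
qed (auto simp: semidirect_def act_act act_mult G.m_assoc M.m_assoc)

sublocale S: group semidirect
  by (rule group_semidirect)

sublocale inG: group_hom G semidirect inG
  by unfold_locales (auto simp: hom_def inG_def semidirect_def)

sublocale inM: group_hom M semidirect inM
  by unfold_locales (auto simp: hom_def inM_def semidirect_def)

lemma inM_eq_one_iff [simp]: "inM m = \<one>\<^bsub>semidirect\<^esub> \<longleftrightarrow> m = \<one>\<^bsub>M\<^esub>"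
  by (simp add: inM_def semidirect_def)

lemma semidirect_eq:
  "x \<in> carrier semidirect \<Longrightarrow> x = inG (fst x) \<otimes>\<^bsub>semidirect\<^esub> inM (snd x)"
  by (auto simp: semidirect_def inG_def inM_def)

lemma semidirect_cases:
  assumes "x \<in> carrier semidirect"
  obtains g m where "g \<in> carrier G" "m \<in> carrier M" "x = inG g \<otimes>\<^bsub>semidirect\<^esub> inM m"
  using semidirect_eq[OF assms] assms by (auto simp: semidirect_def)

lemma conjugate_inM_inG:
  assumes "m \<in> carrier M" "g \<in> carrier G"
  shows "S.cj (inM m) (inG g) = inM (act m g)"
proof -
  have "inM m \<otimes>\<^bsub>semidirect\<^esub> inG g = inG g \<otimes>\<^bsub>semidirect\<^esub> inM (act m g)"
    using assms by (simp add: semidirect_def inG_def inM_def)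
  then show ?thesis using assms by (simp add: conjugate_def S.m_assoc S.inv_cancel_left)
qed

lemma commutator_inM_inG:
  assumes "m \<in> carrier M" "g \<in> carrier G"
  shows "S.cm (inM m) (inG g) = inM (w (d m) g)"
proof -
  have "S.cm (inM m) (inG g) = inv\<^bsub>semidirect\<^esub> (inM m) \<otimes>\<^bsub>semidirect\<^esub> S.cj (inM m) (inG g)"
    using assms by (simp add: S.word_simps)
  then show ?thesis using assms
    by (simp add: conjugate_inM_inG act_eq S.inv_cancel_left)
qed

lemma commutator_inG_inM:
  assumes "m \<in> carrier M" "g \<in> carrier G"
  shows "S.cm (inG g) (inM m) = inM (inv\<^bsub>M\<^esub> (w (d m) g))"
  using S.inv_commutator[of "inM m" "inG g"] assms by (simp add: commutator_inM_inG)

lemma commutator_inM_inM: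
  assumes "m \<in> carrier M" "n \<in> carrier M"
  shows "S.cm (inM m) (inM n) = inM (w (d m) (d n))"
proof -
  have "S.cm (inM m) (inM n) = inM (M.cm m n)"
    using assms by (simp add: commutator_def)
  also have "M.cm m n = inv\<^bsub>M\<^esub> m \<otimes>\<^bsub>M\<^esub> act m (d n)"
    using assms by (simp add: Peiffer M.word_simps)
  finally show ?thesis using assms by (simp add: act_eq M.inv_cancel_left)
qed

lemma inG_commutator:
  "g \<in> carrier G \<Longrightarrow> h \<in> carrier G \<Longrightarrow> inG (G.cm g h) = S.cm (inG g) (inG h)"
  by (simp add: commutator_def)

text \<open>The left product rule is the multiplication of the pairs (t, t \<and> k): for fixed
  \<open>k\<close>, the map t -> t \<and> k is a crossed homomorphism.\<close>

lemma pow_inG_inM_w: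
  assumes "t \<in> carrier G" "k \<in> carrier G"
  shows "(inG t \<otimes>\<^bsub>semidirect\<^esub> inM (w t k)) [^]\<^bsub>semidirect\<^esub> n =
    inG (t [^]\<^bsub>G\<^esub> n) \<otimes>\<^bsub>semidirect\<^esub> inM (w (t [^]\<^bsub>G\<^esub> (n::nat)) k)"
proof (induction n)
  case 0
  show ?case using assms by simp
next
  case (Suc n)
  then show ?case using assms
    by (simp add: w_mult_left) (simp add: semidirect_def inG_def inM_def)
qed

lemma pow_inG_inM_w_eq_one:
  assumes "t \<in> carrier G" "k \<in> carrier G" "t [^]\<^bsub>G\<^esub> (n::nat) = \<one>\<^bsub>G\<^esub>"
  shows "(inG t \<otimes>\<^bsub>semidirect\<^esub> inM (w t k)) [^]\<^bsub>semidirect\<^esub> n = \<one>\<^bsub>semidirect\<^esub>"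
  using assms by (simp add: pow_inG_inM_w)

section \<open>The normal copy of the exterior square and the lower central series of the semidirect
  product\<close>

lemma normal_inM: "inM ` carrier M \<lhd> semidirect"
proof (rule S.normalI_conjugate)
  show "subgroup (inM ` carrier M) semidirect"
    using inM.img_is_subgroup by simp
next
  fix x y assume "x \<in> inM ` carrier M" and y: "y \<in> carrier semidirect"
  then obtain m where m: "m \<in> carrier M" "x = inM m" by blast
  obtain g n where g: "g \<in> carrier G" "n \<in> carrier M" "y = inG g \<otimes>\<^bsub>semidirect\<^esub> inM n"
    using y by (rule semidirect_cases)
  have "S.cj x y = S.cj (inM (act m g)) (inM n)"
    using m g by (simp add: conjugate_inM_inG flip: S.conjugate_conjugate)
  also have "\<dots> = inM (M.cj (act m g) n)" using m g by (simp add: conjugate_def)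
  finally show "S.cj x y \<in> inM ` carrier M" using m g by simp
qed

text \<open>The image of \<open>\<gamma>\<^sub>i\<^sub>+\<^sub>1(G) \<and> G\<close> in
  \<open>M\<close>; it turns out to be the part of the lower central series of the semidirect
  product lying in \<open>M\<close>.\<close>

definition W :: "nat \<Rightarrow> 'b set" where
  "W i = generate M {w t g | t g. t \<in> lower_central G i \<and> g \<in> carrier G}"

lemma W_generators: "{w t g | t g. t \<in> lower_central G i \<and> g \<in> carrier G} \<subseteq> carrier M"
  using G.lower_central_carrier by auto

lemma W_0: "W 0 = carrier M"
  unfolding W_def generated by simp

lemma subgroup_W: "subgroup (W i) M"
  unfolding W_def using W_generators by (rule M.generate_is_subgroup)

lemma W_carrier: "m \<in> W i \<Longrightarrow> m \<in> carrier M"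
  using subgroup_W by (rule subgroup.mem_carrier)

lemma w_in_W: "t \<in> lower_central G i \<Longrightarrow> g \<in> carrier G \<Longrightarrow> w t g \<in> W i"
  unfolding W_def by (auto intro: generate.incl)

lemma w_in_W_right:
  assumes "t \<in> lower_central G i" "g \<in> carrier G" shows "w g t \<in> W i"
  using w_swap[of g t] w_in_W[OF assms] subgroup.m_inv_closed[OF subgroup_W] assms G.lower_central_carrier
  by metis

lemma act_W:
  assumes "m \<in> W i" and k: "k \<in> carrier G"
  shows "act m k \<in> W i"
  using assms(1) unfolding W_def
proof (induction rule: generate.induct)
  case one
  show ?case using k by (simp add: generate.one)
next
  case (incl m)
  then show ?case using k G.normal_conjugate[OF G.normal_lower_central] G.lower_central_carrier
    by (auto simp: act_w intro!: generate.incl) blast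
next
  case (inv m)
  then have "m \<in> carrier M" "act m k \<in> {w t g | t g. t \<in> lower_central G i \<and> g \<in> carrier G}"
    using k G.normal_conjugate[OF G.normal_lower_central] G.lower_central_carrier
    by (auto simp: act_w) blast
  then show ?case using k by (simp only: act_inv) (rule generate.inv)
next
  case (eng m n)
  then have "m \<in> carrier M" "n \<in> carrier M" using W_carrier unfolding W_def by auto
  then show ?case using eng k by (simp add: act_mult generate.eng)
qed

text \<open>The boundary of t \<and> g is [t, g]. This shift by one is the extra depth gained by
  commutators inside \<open>M\<close>.\<close>

lemma d_W:
  assumes "m \<in> W i" shows "d m \<in> lower_central G (Suc i)"
proof -
  note sub = G.subgroup_lower_central[of "Suc i"]
  have 1: "d m \<in> lower_central G (Suc i)"
    if "m \<in> {w t g | t g. t \<in> lower_central G i \<and> g \<in> carrier G}" for m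
    using that G.commutator_lower_central G.lower_central_carrier by (auto simp: d_w)
  show ?thesis using assms unfolding W_def
  proof (induction rule: generate.induct)
    case one
    show ?case using subgroup.one_closed[OF sub] by simp
  next
    case (inv m)
    then have "m \<in> carrier M" using W_generators by blast
    then show ?case using 1[OF inv] subgroup.m_inv_closed[OF sub] by simp
  next
    case (eng m n)
    then have "m \<in> carrier M" "n \<in> carrier M" using W_carrier unfolding W_def by auto
    then show ?case using eng subgroup.m_closed[OF sub] by simp
  qed (rule 1)
qed

text \<open>For generators \<open>n = g \<and> h\<close>, the element \<open>n\<inverse> n\<^sup>t = n\<inverse> (g [g, t] \<and> h [h, t])\<close> expands into
  wedges involving \<open>[g, t]\<close> or \<open>[h, t]\<close>.\<close>

lemma w_d_lower_central:
  assumes "n \<in> carrier M" and t: "t \<in> lower_central G i"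
  shows "w (d n) t \<in> W (Suc i)"
proof -
  note Wm = subgroup.m_closed[OF subgroup_W] and Wi = subgroup.m_inv_closed[OF subgroup_W]
  have [simp]: "t \<in> carrier G" using t by (rule G.lower_central_carrier)
  have 1: "w (G.cm g h) t \<in> W (Suc i)" if [simp]: "g \<in> carrier G" "h \<in> carrier G" for g h
  proof -
    define r where "r = G.cm g t"
    define s where "s = G.cm h t"
    have r: "r \<in> lower_central G (Suc i)" and s: "s \<in> lower_central G (Suc i)"
      using G.commutator_lower_central[OF t] G.normal_commutator_swap[OF G.subgroup_lower_central]
      by (simp_all add: r_def s_def)
    have rs: "s \<otimes>\<^bsub>G\<^esub> r \<in> lower_central G (Suc i)"
      using subgroup.m_closed[OF G.subgroup_lower_central s r] .
    have [simp]: "r \<in> carrier G" "s \<in> carrier G" by (simp_all add: r_def s_def)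
    let ?p = "w g h" and ?A = "act (w g s) r" and ?B = "w (G.cm g h) (s \<otimes>\<^bsub>G\<^esub> r)" and ?C = "w r (h \<otimes>\<^bsub>G\<^esub> s)"
    have A: "?A \<in> W (Suc i)" using s by (intro act_W w_in_W_right) auto
    have B: "?B \<in> W (Suc i)" using rs by (intro w_in_W_right) auto
    have C: "?C \<in> W (Suc i)" using r by (intro w_in_W) auto
    have "act ?p t = w (g \<otimes>\<^bsub>G\<^esub> r) (h \<otimes>\<^bsub>G\<^esub> s)"
      by (simp add: act_w G.conjugate_eq r_def s_def)
    also have "\<dots> = ?A \<otimes>\<^bsub>M\<^esub> act ?p (s \<otimes>\<^bsub>G\<^esub> r) \<otimes>\<^bsub>M\<^esub> ?C"
      by (subst w_mult_left) (simp_all add: w_mult_right[of g h s] act_mult act_act M.m_assoc)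
    also have "act ?p (s \<otimes>\<^bsub>G\<^esub> r) = ?p \<otimes>\<^bsub>M\<^esub> ?B"
      by (simp add: w_commutator)
    finally have "w (G.cm g h) t = M.cj ?A ?p \<otimes>\<^bsub>M\<^esub> ?B \<otimes>\<^bsub>M\<^esub> ?C"
      using w_commutator[of g h t] by (simp add: conjugate_def M.m_assoc M.inv_solve_left)
    also have "M.cj ?A ?p = act ?A (d ?p)" by (simp add: Peiffer)
    finally show ?thesis using A B C by (auto intro!: Wm act_W)
  qed
  have "n \<in> generate M {w g h | g h. g \<in> carrier G \<and> h \<in> carrier G}"
    using assms(1) generated by simp
  then have "n \<in> carrier M \<and> w (d n) t \<in> W (Suc i)"
  proof (induction rule: generate.induct)
    case one
    show ?case using subgroup.one_closed[OF subgroup_W] by simp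
  next
    case (incl n)
    then show ?case using 1 by (auto simp: d_w)
  next
    case (inv n)
    then have "n \<in> carrier M" "w (d n) t \<in> W (Suc i)" using 1 by (auto simp: d_w)
    then show ?case by (auto simp: w_inv_left intro!: act_W Wi)
  next
    case (eng n n')
    then show ?case by (auto simp: w_mult_left intro!: Wm act_W)
  qed
  then show ?thesis by simp
qed

text \<open>An upper bound for the lower central series of the semidirect product, explicit enough
  to read off triviality and the intersection with \<open>M\<close>.\<close>

definition GW :: "nat \<Rightarrow> ('a \<times> 'b) set" where
  "GW i = {inG t \<otimes>\<^bsub>semidirect\<^esub> inM m | t m. t \<in> lower_central G i \<and> m \<in> W i}"

lemma inG_GW: "t \<in> lower_central G i \<Longrightarrow> inG t \<in> GW i"
  using subgroup.one_closed[OF subgroup_W[of i]] G.lower_central_carrier[of t i]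
  unfolding GW_def by (auto intro!: exI[of _ t] exI[of _ "\<one>\<^bsub>M\<^esub>"])

lemma inM_GW: "m \<in> W i \<Longrightarrow> inM m \<in> GW i"
  using subgroup.one_closed[OF G.subgroup_lower_central[of i]] W_carrier[of m i]
  unfolding GW_def by (auto intro!: exI[of _ "\<one>\<^bsub>G\<^esub>"] exI[of _ m])

lemma GW_subset: "GW i \<subseteq> carrier semidirect"
  unfolding GW_def using G.lower_central_carrier W_carrier by auto

lemma normal_GW: "GW i \<lhd> semidirect"
proof -
  note Wm = subgroup.m_closed[OF subgroup_W] and Wi = subgroup.m_inv_closed[OF subgroup_W]
  note Lm = subgroup.m_closed[OF G.subgroup_lower_central]
    and Li = subgroup.m_inv_closed[OF G.subgroup_lower_central]
  note car = G.lower_central_carrier W_carrier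
  have move: "inM m \<otimes>\<^bsub>semidirect\<^esub> inG t = inG t \<otimes>\<^bsub>semidirect\<^esub> inM (act m t)"
    if "m \<in> carrier M" "t \<in> carrier G" for m t
    using that by (simp add: semidirect_def inG_def inM_def)
  have mult: "x \<otimes>\<^bsub>semidirect\<^esub> y \<in> GW i" if xy: "x \<in> GW i" "y \<in> GW i" for x y
  proof -
    obtain t m where x: "t \<in> lower_central G i" "m \<in> W i" "x = inG t \<otimes>\<^bsub>semidirect\<^esub> inM m"
      using xy(1) unfolding GW_def by blast
    obtain s n where y: "s \<in> lower_central G i" "n \<in> W i" "y = inG s \<otimes>\<^bsub>semidirect\<^esub> inM n"
      using xy(2) unfolding GW_def by blast
    note c [simp] = car(1)[OF x(1)] car(2)[OF x(2)] car(1)[OF y(1)] car(2)[OF y(2)]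
    have "x \<otimes>\<^bsub>semidirect\<^esub> y = inG (t \<otimes>\<^bsub>G\<^esub> s) \<otimes>\<^bsub>semidirect\<^esub> inM (act m s \<otimes>\<^bsub>M\<^esub> n)"
      unfolding x(3) y(3) by (simp add: semidirect_def inG_def inM_def)
    moreover have "t \<otimes>\<^bsub>G\<^esub> s \<in> lower_central G i" "act m s \<otimes>\<^bsub>M\<^esub> n \<in> W i"
      using x y Lm by (auto intro!: Wm act_W)
    ultimately show ?thesis unfolding GW_def by blast
  qed
  have sub: "subgroup (GW i) semidirect"
  proof (rule S.subgroupI[OF GW_subset])
    show "GW i \<noteq> {}" using inM_GW subgroup.one_closed[OF subgroup_W] by blast
  next
    fix x assume "x \<in> GW i"
    then obtain t m where x: "t \<in> lower_central G i" "m \<in> W i" "x = inG t \<otimes>\<^bsub>semidirect\<^esub> inM m"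
      unfolding GW_def by blast
    then have "inv\<^bsub>semidirect\<^esub> x = inM (inv\<^bsub>M\<^esub> m) \<otimes>\<^bsub>semidirect\<^esub> inG (inv\<^bsub>G\<^esub> t)"
      using car by (simp add: S.inv_mult_group)
    then show "inv\<^bsub>semidirect\<^esub> x \<in> GW i"
      using x Wi Li by (simp add: mult inG_GW inM_GW)
  qed (rule mult)
  have cjG: "S.cj x (inG g) \<in> GW i" if x: "x \<in> GW i" and g: "g \<in> carrier G" for x g
  proof -
    obtain t m where x: "t \<in> lower_central G i" "m \<in> W i" "x = inG t \<otimes>\<^bsub>semidirect\<^esub> inM m"
      using x unfolding GW_def by blast
    have "S.cj (inG t) (inG g) = inG (G.cj t g)"
      using x g car by (simp add: conjugate_def)
    then have "S.cj x (inG g) = inG (G.cj t g) \<otimes>\<^bsub>semidirect\<^esub> inM (act m g)"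
      using x g car by (simp add: S.conjugate_mult conjugate_inM_inG)
    moreover have "G.cj t g \<in> lower_central G i" "act m g \<in> W i"
      using x g by (auto intro: act_W G.normal_conjugate[OF G.normal_lower_central])
    ultimately show ?thesis unfolding GW_def by blast
  qed
  have cjM: "S.cj x (inM n) \<in> GW i" if x: "x \<in> GW i" and n: "n \<in> carrier M" for x n
  proof -
    obtain t m where x: "t \<in> lower_central G i" "m \<in> W i" "x = inG t \<otimes>\<^bsub>semidirect\<^esub> inM m"
      using x unfolding GW_def by blast
    note [simp] = car(1)[OF x(1)] car(2)[OF x(2)]
    have "w (d n) t \<in> W i" using x by (intro w_in_W_right) (use n in auto)
    then have "S.cj (inG t) (inM n) \<in> GW i"
      using n x Wi by (simp add: S.conjugate_eq commutator_inG_inM mult inG_GW inM_GW del: inM.hom_inv)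
    moreover have "S.cj (inM m) (inM n) = inM (act m (d n))"
      using n by (simp add: Peiffer conjugate_def)
    ultimately show ?thesis
      using n x(1,2) unfolding x(3) by (simp add: S.conjugate_mult mult inM_GW act_W)
  qed
  show ?thesis
  proof (rule S.normalI_conjugate[OF sub])
    fix x y assume x: "x \<in> GW i" and "y \<in> carrier semidirect"
    then obtain g n where g: "g \<in> carrier G" "n \<in> carrier M" "y = inG g \<otimes>\<^bsub>semidirect\<^esub> inM n"
      by (meson semidirect_cases)
    have "x \<in> carrier semidirect" using x GW_subset by blast
    then have "S.cj x y = S.cj (S.cj x (inG g)) (inM n)" using g by (simp add: S.conjugate_conjugate)
    then show "S.cj x y \<in> GW i" using cjM[OF cjG[OF x g(1)] g(2)] by simp
  qed
qed

text \<open>Splitting both arguments into a \<open>G\<close> part and an \<open>M\<close> part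
  leaves four kinds of commutators. The delicate one pairs \<open>t\<close> of depth
  \<open>i\<close> with an arbitrary \<open>n\<close> of \<open>M\<close>: it is the inverse of d n
  \<and> t, and only \<open>w_d_lower_central\<close> puts this one level deeper.\<close>

lemma lower_central_semidirect_subset: "lower_central semidirect i \<subseteq> GW i"
proof (induction i)
  case 0
  show ?case by (auto simp: GW_def W_0 elim!: semidirect_cases)
next
  case (Suc i)
  note N = normal_GW[of "Suc i"]
  note sub = normal_imp_subgroup[OF N]
  note mcl = subgroup.m_closed[OF sub] and cj = S.normal_conjugate[OF N]
  show ?case
  proof (rule S.lower_central_SucI[OF N])
    fix x y assume "x \<in> lower_central semidirect i" and y: "y \<in> carrier semidirect"
    then have "x \<in> GW i" using Suc by blast
    then obtain t m where x: "t \<in> lower_central G i" "m \<in> W i" "x = inG t \<otimes>\<^bsub>semidirect\<^esub> inM m"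
      unfolding GW_def by blast
    obtain g n where g: "g \<in> carrier G" "n \<in> carrier M" "y = inG g \<otimes>\<^bsub>semidirect\<^esub> inM n"
      using y by (rule semidirect_cases)
    note [simp] = G.lower_central_carrier[OF x(1)] W_carrier[OF x(2)] g(1,2)
    have tg: "S.cm (inG t) (inG g) \<in> GW (Suc i)"
      using x g by (simp flip: inG_commutator add: inG_GW G.commutator_lower_central)
    have tn: "S.cm (inG t) (inM n) \<in> GW (Suc i)"
      using w_d_lower_central[OF g(2) x(1)] subgroup.m_inv_closed[OF subgroup_W]
      by (simp add: commutator_inG_inM inM_GW del: inM.hom_inv)
    have mk: "inM (w (d m) k) \<in> GW (Suc i)" if "k \<in> carrier G" for k
      using that d_W[OF x(2)] by (intro inM_GW w_in_W)
    have "S.cm (inG t) y \<in> GW (Suc i)"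
      unfolding g(3) using tg tn by (subst S.commutator_mult_right) (auto intro!: mcl cj)
    moreover have "S.cm (inM m) y \<in> GW (Suc i)"
      unfolding g(3) using mk
      by (subst S.commutator_mult_right) (auto intro!: mcl cj simp: commutator_inM_inG commutator_inM_inM)
    ultimately show "S.cm x y \<in> GW (Suc i)"
      unfolding x(3) using y by (subst S.commutator_mult_left) (auto intro!: mcl cj)
  qed
qed

text \<open>One direction reads off the \<open>M\<close> component in \<open>GW i\<close>. The other
  is an induction based on [s, k] \<and> g = [s \<and> k, g], the commutator on the right being
  taken in the semidirect product.\<close>

lemma inM_lower_central_iff:
  assumes "m \<in> carrier M"
  shows "inM m \<in> lower_central semidirect i \<longleftrightarrow> m \<in> W i"
proof
  assume "inM m \<in> lower_central semidirect i"
  then have "inM m \<in> GW i" using lower_central_semidirect_subset by blast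
  then obtain t n where "t \<in> lower_central G i" "n \<in> W i" "inM m = inG t \<otimes>\<^bsub>semidirect\<^esub> inM n"
    unfolding GW_def by blast
  then show "m \<in> W i"
    using W_carrier[of n i] G.lower_central_carrier[of t i] by (simp add: inM_def inG_def semidirect_def)
next
  note sub = S.subgroup_lower_central
  have w: "inM (w t g) \<in> lower_central semidirect i" if "t \<in> lower_central G i" "g \<in> carrier G" for t g
    using that
  proof (induction i arbitrary: t g)
    case 0
    then show ?case by simp
  next
    case (Suc i)
    have base: "inM (w (G.cm s k) g) \<in> lower_central semidirect (Suc i)"
      if "s \<in> lower_central G i" "k \<in> carrier G" for s k
    proof -
      have [simp]: "s \<in> carrier G" using that(1) by (rule G.lower_central_carrier)
      have "inM (w (G.cm s k) g) = S.cm (inM (w s k)) (inG g)"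
        using that Suc.prems by (simp add: commutator_inM_inG d_w)
      then show ?thesis using Suc.IH[OF that] Suc.prems(2) by (simp add: S.commutator_lower_central)
    qed
    have "t \<in> carrier G \<and> inM (w t g) \<in> lower_central semidirect (Suc i)"
      using Suc.prems(1) unfolding lower_central.simps(2)[of G]
    proof (induction rule: generate.induct)
      case one
      show ?case using Suc.prems(2) subgroup.one_closed[OF sub] by simp
    next
      case (incl t)
      then show ?case using base G.lower_central_carrier by auto
    next
      case (inv t)
      then have t: "t \<in> carrier G" "inM (w t g) \<in> lower_central semidirect (Suc i)"
        using base G.lower_central_carrier by auto
      then show ?case
        using Suc.prems(2) S.normal_conjugate[OF S.normal_lower_central] subgroup.m_inv_closed[OF sub]
        by (simp add: w_inv_left flip: conjugate_inM_inG)
    next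
      case (eng t s)
      then show ?case
        using Suc.prems(2) S.normal_conjugate[OF S.normal_lower_central] subgroup.m_closed[OF sub]
        by (simp add: w_mult_left flip: conjugate_inM_inG)
    qed
    then show ?case by simp
  qed
  assume "m \<in> W i"
  then have "m \<in> carrier M \<and> inM m \<in> lower_central semidirect i"
    unfolding W_def
  proof (induction rule: generate.induct)
    case one
    show ?case using subgroup.one_closed[OF sub] by simp
  next
    case (incl m)
    then show ?case using w G.lower_central_carrier by auto
  next
    case (inv m)
    then have "m \<in> carrier M" "inM m \<in> lower_central semidirect i" using w G.lower_central_carrier by auto
    then show ?case using subgroup.m_inv_closed[OF sub] by simp
  next
    case (eng m n)
    then show ?case using subgroup.m_closed[OF sub] by simp
  qed
  then show "inM m \<in> lower_central semidirect i" by simp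
qed

lemma inG_lower_central:
  "t \<in> lower_central G i \<Longrightarrow> inG t \<in> lower_central semidirect i"
proof (induction i arbitrary: t)
  case 0
  then show ?case by simp
next
  case (Suc i)
  note sub = S.subgroup_lower_central
  have base: "inG (G.cm s k) \<in> lower_central semidirect (Suc i)"
    if "s \<in> lower_central G i" "k \<in> carrier G" for s k
    using that Suc.IH[OF that(1)] G.lower_central_carrier[OF that(1)]
    by (simp add: inG_commutator S.commutator_lower_central)
  have "t \<in> carrier G \<and> inG t \<in> lower_central semidirect (Suc i)"
    using Suc.prems(1) unfolding lower_central.simps(2)[of G]
  proof (induction rule: generate.induct)
    case one
    show ?case using subgroup.one_closed[OF sub] by simp
  next
    case (incl t)
    then show ?case using base G.lower_central_carrier by auto
  next
    case (inv t)
    then have "t \<in> carrier G" "inG t \<in> lower_central semidirect (Suc i)"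
      using base G.lower_central_carrier by auto
    then show ?case using subgroup.m_inv_closed[OF sub] by simp
  next
    case (eng t s)
    then show ?case using subgroup.m_closed[OF sub] by simp
  qed
  then show ?case by simp
qed

lemma lower_central_semidirect_trivial:
  assumes "lower_central G i = {\<one>\<^bsub>G\<^esub>}"
  shows "lower_central semidirect i = {\<one>\<^bsub>semidirect\<^esub>}"
proof -
  have "{w t g | t g. t \<in> lower_central G i \<and> g \<in> carrier G} \<subseteq> {\<one>\<^bsub>M\<^esub>}"
    using assms by auto
  then have "W i \<subseteq> {\<one>\<^bsub>M\<^esub>}"
    unfolding W_def by (rule M.generate_subgroup_incl[OF _ M.triv_subgroup])
  then have "GW i \<subseteq> {\<one>\<^bsub>semidirect\<^esub>}" using assms by (auto simp: GW_def)
  then show ?thesis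
    using lower_central_semidirect_subset subgroup.one_closed[OF S.subgroup_lower_central] by blast
qed

end

section \<open>The exponent of the exterior square\<close>

text \<open>For v = [u, x] the left side is the weight 3 expression, since u u^x = u u v. Writing (u
  u v)^y as u u v [u u v, y] cancels the powers of \<open>u\<close> and isolates v = [y, x, x], up
  to a commutator that is deep when \<open>y\<close> lies in the exterior square.\<close>

lemma (in group) conjugate_triple_product:
  assumes "u \<in> carrier G" "v \<in> carrier G" "y \<in> carrier G"
  shows "inv (u \<otimes> u \<otimes> u) \<otimes> cj (u \<otimes> (u \<otimes> v)) y \<otimes> u = cj (v \<otimes> cm (u \<otimes> (u \<otimes> v)) y) u"
  using assms by (simp add: word_simps)

theorem (in exterior_pairing) three_group_exponent:
  assumes triv: "lower_central G 5 = {\<one>\<^bsub>G\<^esub>}"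
    and q: "(q::nat) = 3 ^ k"
    and exp: "\<And>x. x \<in> carrier G \<Longrightarrow> x [^]\<^bsub>G\<^esub> (3 * q) = \<one>\<^bsub>G\<^esub>"
    and m: "m \<in> carrier M"
  shows "m [^]\<^bsub>M\<^esub> (3 * q) = \<one>\<^bsub>M\<^esub>"
proof -
  let ?S = semidirect and ?H = "inM ` carrier M" and ?e = "3 * q"
  define P where "P i = lower_central ?S i \<inter> ?H" for i
  note bin = binomial_three_power[OF q HOL.refl]
  note trivS = lower_central_semidirect_trivial[OF triv]
  have P: "P i \<lhd> ?S" for i
    unfolding P_def by (intro S.normal_subgroup_intersect S.normal_lower_central normal_inM)
  note subP = normal_imp_subgroup[OF P]
  have PS [simp]: "a \<in> P i \<Longrightarrow> a \<in> carrier ?S" for a i using subP by (rule subgroup.mem_carrier)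
  have HS [simp]: "a \<in> ?H \<Longrightarrow> a \<in> carrier ?S" for a by auto
  have P_le: "P j \<subseteq> P i" if "i \<le> j" for i j
    unfolding P_def using S.lower_central_antimono[OF that] by blast
  have inM_P: "inM n \<in> P i \<longleftrightarrow> n \<in> W i" if "n \<in> carrier M" for n i
    using that by (auto simp: P_def inM_lower_central_iff)
  have P_0: "?H = P 0" by (auto simp: P_def)
  have P_cases: "\<exists>n. n \<in> W i \<and> a = inM n" if "a \<in> P i" for a i
    using that inM_P by (auto simp: P_def inM_lower_central_iff)
  \<comment> \<open>Since n acts on \<open>M\<close> as d n does, [m, n] = [m, d n], and d n has
    depth \<open>j + 1\<close>. Hence the index grows by 2, against 1 in \<open>cm_P_S\<close>. As
    \<open>P 5\<close> is trivial, \<open>3 \<le> i + j\<close> suffices for commutation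
    below.\<close>
  have cm_P: "S.cm a b \<in> P (i + j + 2)" if ab: "a \<in> P i" "b \<in> P j" for a b i j
  proof -
    obtain m n where m: "m \<in> W i" "a = inM m" and n: "n \<in> W j" "b = inM n"
      using P_cases[OF ab(1)] P_cases[OF ab(2)] by blast
    note [simp] = W_carrier[OF m(1)] W_carrier[OF n(1)]
    have "S.cm a b = S.cm a (inG (d n))"
      unfolding m n by (simp add: commutator_inM_inM commutator_inM_inG)
    moreover have "S.cm a (inG (d n)) \<in> lower_central ?S (Suc (i + Suc j))"
      using ab(1) d_W[OF n(1)]
      by (intro S.commutator_lower_central_lower_central inG_lower_central) (auto simp: P_def)
    moreover have "S.cm a b \<in> ?H" unfolding m n by (simp add: commutator_inM_inM)
    ultimately show ?thesis by (simp add: P_def)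
  qed
  have cm_P_S: "S.cm a x \<in> P (Suc (i + j))"
    if "a \<in> P i" "x \<in> lower_central ?S j" for a x i j
  proof -
    have "S.cm a x \<in> lower_central ?S (Suc (i + j))"
      using that by (intro S.commutator_lower_central_lower_central) (auto simp: P_def)
    moreover have "S.cm a x \<in> ?H"
      using that S.lower_central_carrier by (intro S.normal_commutator(1)[OF normal_inM]) (auto simp: P_def)
    ultimately show ?thesis by (simp add: P_def)
  qed
  have P_triv: "a = \<one>\<^bsub>?S\<^esub>" if "a \<in> P i" "5 \<le> i" for a i
    using that S.lower_central_antimono[OF that(2)] trivS by (auto simp: P_def)
  have commute: "a \<otimes>\<^bsub>?S\<^esub> b = b \<otimes>\<^bsub>?S\<^esub> a" if "a \<in> P i" "b \<in> P j" "3 \<le> i + j" for a b i j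
    using P_triv[OF cm_P[OF that(1,2)]] that by (simp flip: S.commutator_eq_one_iff)
  \<comment> \<open>Closure under products is a hypothesis, because \<open>P i\<close> need not be
    abelian for small \<open>i\<close>; each level supplies its own argument.\<close>
  have torsion: "a [^]\<^bsub>?S\<^esub> n = \<one>\<^bsub>?S\<^esub>"
    if a: "a \<in> P i"
      and gen: "\<And>t l. t \<in> lower_central G i \<Longrightarrow> l \<in> carrier G \<Longrightarrow> inM (w t l) [^]\<^bsub>?S\<^esub> n = \<one>\<^bsub>?S\<^esub>"
      and mult: "\<And>a b. a \<in> P i \<Longrightarrow> b \<in> P i \<Longrightarrow> a [^]\<^bsub>?S\<^esub> n = \<one>\<^bsub>?S\<^esub> \<Longrightarrow> b [^]\<^bsub>?S\<^esub> n = \<one>\<^bsub>?S\<^esub> \<Longrightarrow>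
        (a \<otimes>\<^bsub>?S\<^esub> b) [^]\<^bsub>?S\<^esub> n = \<one>\<^bsub>?S\<^esub>" for a i and n :: nat
  proof -
    obtain m where m: "m \<in> W i" "a = inM m" using P_cases[OF a] by blast
    have "m \<in> W i \<and> inM m [^]\<^bsub>?S\<^esub> n = \<one>\<^bsub>?S\<^esub>" using m(1) unfolding W_def
    proof (induction rule: generate.induct)
      case (inv m)
      then have "m \<in> carrier M" using W_generators by blast
      then show ?case using inv gen by (auto simp: S.nat_pow_inv intro: generate.inv)
    next
      case (eng m n)
      then have mn: "m \<in> W i" "n \<in> W i" by (simp_all add: W_def)
      then have "inM m \<in> P i" "inM n \<in> P i" using W_carrier inM_P by blast+
      then show ?case using mult eng W_carrier[OF mn(1)] W_carrier[OF mn(2)]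
        by (simp add: generate.eng)
    qed (use gen in \<open>auto intro: generate.intros\<close>)
    then show ?thesis using m by simp
  qed
  \<comment> \<open>For \<open>i \<ge> 2\<close> the commutator of t \<and> l with \<open>t\<close>
    has index at least 5, so the two commute and the power of t (t \<and> l) splits.\<close>
  have w_pow: "inM (w t l) [^]\<^bsub>?S\<^esub> n = \<one>\<^bsub>?S\<^esub>"
    if t: "t \<in> lower_central G i" and l: "l \<in> carrier G" and i: "2 \<le> i"
      and tn: "t [^]\<^bsub>G\<^esub> n = \<one>\<^bsub>G\<^esub>" for t l i and n :: nat
  proof -
    have [simp]: "t \<in> carrier G" using t by (rule G.lower_central_carrier)
    have "inM (w t l) \<in> P i" using t l by (simp add: inM_P w_in_W)
    from P_triv[OF cm_P_S[OF this inG_lower_central[OF t]]] i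
    have "inM (w t l) \<otimes>\<^bsub>?S\<^esub> inG t = inG t \<otimes>\<^bsub>?S\<^esub> inM (w t l)"
      using l by (simp flip: S.commutator_eq_one_iff)
    then have "inG t [^]\<^bsub>?S\<^esub> n \<otimes>\<^bsub>?S\<^esub> inM (w t l) [^]\<^bsub>?S\<^esub> n = \<one>\<^bsub>?S\<^esub>"
      using pow_inG_inM_w_eq_one[OF _ l tn] l by (simp add: S.pow_mult_distrib)
    then show ?thesis using tn l by (simp flip: inG.hom_nat_pow)
  qed
  have P3: "a [^]\<^bsub>?S\<^esub> q = \<one>\<^bsub>?S\<^esub>" if "a \<in> P 3" for a
    using that
  proof (rule torsion)
    fix t l assume "t \<in> lower_central G 3" "l \<in> carrier G"
    then show "inM (w t l) [^]\<^bsub>?S\<^esub> q = \<one>\<^bsub>?S\<^esub>"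
      using G.three_group_class_5(2)[OF triv q exp] by (intro w_pow) auto
  qed (use commute[of _ 3 _ 3] in \<open>simp add: S.pow_mult_distrib\<close>)
  have P2: "a [^]\<^bsub>?S\<^esub> ?e = \<one>\<^bsub>?S\<^esub>" if "a \<in> P 2" for a
    using that
  proof (rule torsion)
    fix t l assume t: "t \<in> lower_central G 2" "l \<in> carrier G"
    show "inM (w t l) [^]\<^bsub>?S\<^esub> ?e = \<one>\<^bsub>?S\<^esub>"
      by (rule w_pow[OF t _ exp[OF G.lower_central_carrier[OF t(1)]]]) simp
  qed (use commute[of _ 2 _ 2] in \<open>simp add: S.pow_mult_distrib\<close>)
  \<comment> \<open>The hypothesis on \<open>u\<close> uses the full exponent, but the one on
    [y, x, x] asks for \<open>q\<close>, as only q divides the exponent of the weight 3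
    term.\<close>
  have expand: "(x \<otimes>\<^bsub>?S\<^esub> y) [^]\<^bsub>?S\<^esub> ?e = x [^]\<^bsub>?S\<^esub> ?e \<otimes>\<^bsub>?S\<^esub> y [^]\<^bsub>?S\<^esub> ?e"
    if x: "x \<in> carrier ?S" and y: "y \<in> ?H"
      and u: "S.cm y x [^]\<^bsub>?S\<^esub> ?e = \<one>\<^bsub>?S\<^esub>"
      and v: "S.cm (S.cm y x) x [^]\<^bsub>?S\<^esub> q = \<one>\<^bsub>?S\<^esub>" for x y
  proof -
    let ?u = "S.cm y x" and ?v = "S.cm (S.cm y x) x"
    let ?r = "S.cm (?u \<otimes>\<^bsub>?S\<^esub> (?u \<otimes>\<^bsub>?S\<^esub> ?v)) y"
    let ?d = "inv\<^bsub>?S\<^esub> (?u \<otimes>\<^bsub>?S\<^esub> ?u \<otimes>\<^bsub>?S\<^esub> ?u) \<otimes>\<^bsub>?S\<^esub> S.cj (?u \<otimes>\<^bsub>?S\<^esub> S.cj ?u x) y \<otimes>\<^bsub>?S\<^esub> ?u"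
    have y0: "y \<in> P 0" using y P_0 by simp
    have x0: "x \<in> lower_central ?S 0" using x by simp
    have u1: "?u \<in> P 1" using cm_P_S[OF y0 x0] by simp
    have v2: "?v \<in> P 2" using cm_P_S[OF u1 x0] by (simp add: numeral_2_eq_2)
    have "?u \<otimes>\<^bsub>?S\<^esub> (?u \<otimes>\<^bsub>?S\<^esub> ?v) \<in> P 1"
      using u1 v2 P_le[of 1 2] by (auto intro!: subgroup.m_closed[OF subP])
    \<comment> \<open>Here the index is 1 + 0 + 2: the gain of 2, due to \<open>y\<close> lying in
      the exterior square, brings the error term into \<open>P 3\<close>, already killed by
      \<open>q\<close>.\<close>
    from cm_P[OF this y0] have r: "?r \<in> P 3" by (simp add: numeral_3_eq_3)
    have "?d = S.cj (?v \<otimes>\<^bsub>?S\<^esub> ?r) ?u"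
      using S.conjugate_triple_product[of ?u ?v y] x y u1 by (simp add: S.conjugate_eq[of ?u x])
    moreover have "(?v \<otimes>\<^bsub>?S\<^esub> ?r) [^]\<^bsub>?S\<^esub> q = \<one>\<^bsub>?S\<^esub>"
      using commute[OF v2 r] v P3[OF r] PS[OF v2] PS[OF r] by (simp add: S.pow_mult_distrib)
    moreover have vr: "?v \<otimes>\<^bsub>?S\<^esub> ?r \<in> carrier ?S" using PS[OF v2] PS[OF r] by simp
    ultimately have d: "S.cj ?d y [^]\<^bsub>?S\<^esub> q = \<one>\<^bsub>?S\<^esub>"
      using x y by (simp flip: S.conjugate_pow)
    obtain c4 c5 where
      HP: "\<forall>n. (x \<otimes>\<^bsub>?S\<^esub> y) [^]\<^bsub>?S\<^esub> (n::nat) = x [^]\<^bsub>?S\<^esub> n \<otimes>\<^bsub>?S\<^esub> y [^]\<^bsub>?S\<^esub> n \<otimes>\<^bsub>?S\<^esub>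
        (S.cj ?u y [^]\<^bsub>?S\<^esub> (n choose 2) \<otimes>\<^bsub>?S\<^esub> S.cj ?d y [^]\<^bsub>?S\<^esub> (n choose 3)
        \<otimes>\<^bsub>?S\<^esub> c4 [^]\<^bsub>?S\<^esub> (n choose 4) \<otimes>\<^bsub>?S\<^esub> c5 [^]\<^bsub>?S\<^esub> (n choose 5))"
      and "S.cj ?d y \<in> lower_central ?S 2"
      and c: "c4 \<in> lower_central ?S 3" "c4 \<in> ?H" "c5 \<in> lower_central ?S 4" "c5 \<in> ?H"
      by (rule S.Hall_Petrescu_5[OF trivS x y normal_inM]) blast
    \<comment> \<open>Taking the exterior square as the normal subgroup \<open>D\<close> is what
      places these coefficients in \<open>P 3\<close> and not just in the lower central
      series.\<close>
    have c45P: "c4 \<in> P 3" "c5 \<in> P 3"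
      using c S.lower_central_antimono[of 3 4] by (auto simp: P_def)
    have "q dvd ?e" by simp
    then have c45: "c4 [^]\<^bsub>?S\<^esub> (?e choose 4) = \<one>\<^bsub>?S\<^esub>" "c5 [^]\<^bsub>?S\<^esub> (?e choose 5) = \<one>\<^bsub>?S\<^esub>"
      using S.pow_eq_one_dvd[OF PS[OF c45P(1)] P3[OF c45P(1)] dvd_trans[OF _ bin(2)]]
        S.pow_eq_one_dvd[OF PS[OF c45P(2)] P3[OF c45P(2)] dvd_trans[OF _ bin(3)]] by blast+
    have c3: "S.cj ?d y [^]\<^bsub>?S\<^esub> (?e choose 3) = \<one>\<^bsub>?S\<^esub>"
      using x y bin(4) by (intro S.pow_eq_one_dvd[OF _ d]) auto
    have u': "S.cj ?u y [^]\<^bsub>?S\<^esub> ?e = \<one>\<^bsub>?S\<^esub>"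
      using u x y by (simp flip: S.conjugate_pow)
    have c2: "S.cj ?u y [^]\<^bsub>?S\<^esub> (?e choose 2) = \<one>\<^bsub>?S\<^esub>"
      using x y bin(1) by (intro S.pow_eq_one_dvd[OF _ u']) auto
    show ?thesis unfolding HP[rule_format] c2 c3 c45 using x y by simp
  qed
  have expand_P3: "(x \<otimes>\<^bsub>?S\<^esub> y) [^]\<^bsub>?S\<^esub> ?e = x [^]\<^bsub>?S\<^esub> ?e \<otimes>\<^bsub>?S\<^esub> y [^]\<^bsub>?S\<^esub> ?e"
    if x: "x \<in> carrier ?S" and y: "y \<in> ?H" and u: "S.cm y x \<in> P 3" for x y
  proof (rule expand[OF x y])
    show "S.cm y x [^]\<^bsub>?S\<^esub> ?e = \<one>\<^bsub>?S\<^esub>"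
      by (rule S.pow_eq_one_dvd[OF PS[OF u] P3[OF u]]) simp
    show "S.cm (S.cm y x) x [^]\<^bsub>?S\<^esub> q = \<one>\<^bsub>?S\<^esub>"
      by (rule P3[OF S.normal_commutator(1)[OF P u x]])
  qed
  have P1: "a [^]\<^bsub>?S\<^esub> ?e = \<one>\<^bsub>?S\<^esub>" if "a \<in> P 1" for a
    using that
  proof (rule torsion)
    fix t l assume t: "t \<in> lower_central G 1" "l \<in> carrier G"
    have tc [simp]: "t \<in> carrier G" using t(1) by (rule G.lower_central_carrier)
    have "inM (w t l) \<in> P 1" using t by (simp add: inM_P w_in_W)
    from cm_P_S[OF this inG_lower_central[OF t(1)]]
    have "S.cm (inM (w t l)) (inG t) \<in> P 3" by (simp add: numeral_3_eq_3)
    then have "inG t [^]\<^bsub>?S\<^esub> ?e \<otimes>\<^bsub>?S\<^esub> inM (w t l) [^]\<^bsub>?S\<^esub> ?e = \<one>\<^bsub>?S\<^esub>"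
      using expand_P3[of "inG t" "inM (w t l)"] pow_inG_inM_w_eq_one[OF tc t(2) exp] t by simp
    then show "inM (w t l) [^]\<^bsub>?S\<^esub> ?e = \<one>\<^bsub>?S\<^esub>"
      using exp t by (simp flip: inG.hom_nat_pow)
  next
    fix a b assume ab: "a \<in> P 1" "b \<in> P 1" "a [^]\<^bsub>?S\<^esub> ?e = \<one>\<^bsub>?S\<^esub>" "b [^]\<^bsub>?S\<^esub> ?e = \<one>\<^bsub>?S\<^esub>"
    have "S.cm b a \<in> P 3" using cm_P[OF ab(2,1)] P_le[of 3 "1 + 1 + 2"] by auto
    then show "(a \<otimes>\<^bsub>?S\<^esub> b) [^]\<^bsub>?S\<^esub> ?e = \<one>\<^bsub>?S\<^esub>"
      using expand_P3[of a b] ab P_le[of 0 1] P_0 by auto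
  qed
  have u_pow: "S.cm y x [^]\<^bsub>?S\<^esub> ?e = \<one>\<^bsub>?S\<^esub>" if "y \<in> ?H" "x \<in> carrier ?S" for x y
    using cm_P_S[of y 0 x 0] that P_0 by (intro P1) simp
  have "inM m \<in> P 0" using m P_0 by blast
  then have "inM m [^]\<^bsub>?S\<^esub> ?e = \<one>\<^bsub>?S\<^esub>"
  proof (rule torsion)
    fix g h assume "g \<in> lower_central G 0" and h: "h \<in> carrier G"
    then have g: "g \<in> carrier G" by simp
    let ?t = "G.cm (G.cm g h) g"
    \<comment> \<open>\<open>three_group_class_5\<close> speaks of [h, g, g], the expansion of
      [g, h, g]. They are inverse to each other up to conjugation, so both are killed by
      \<open>q\<close>.\<close>
    have "?t = G.cj (inv\<^bsub>G\<^esub> (G.cm (G.cm h g) g)) (inv\<^bsub>G\<^esub> (G.cm h g))"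
      using g h by (simp flip: G.inv_commutator[of h g] add: G.commutator_inv_left del: G.inv_commutator)
    then have "?t [^]\<^bsub>G\<^esub> q = \<one>\<^bsub>G\<^esub>"
      using G.three_group_class_5(1)[OF triv q exp g h] g h
      by (simp add: G.nat_pow_inv flip: G.conjugate_pow)
    moreover have "?t \<in> lower_central G 2"
      using g h G.commutator_lower_central[of g 0 h] G.commutator_lower_central[of "G.cm g h" 1 g]
      by (simp add: numeral_2_eq_2)
    ultimately have "inM (w ?t g) [^]\<^bsub>?S\<^esub> q = \<one>\<^bsub>?S\<^esub>"
      using g by (intro w_pow[of _ 2]) auto
    moreover have "S.cm (S.cm (inM (w g h)) (inG g)) (inG g) = inM (w ?t g)"
      using g h by (simp add: commutator_inM_inG d_w)
    ultimately have "inG g [^]\<^bsub>?S\<^esub> ?e \<otimes>\<^bsub>?S\<^esub> inM (w g h) [^]\<^bsub>?S\<^esub> ?e = \<one>\<^bsub>?S\<^esub>"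
      using expand[of "inG g" "inM (w g h)"] u_pow[of "inM (w g h)" "inG g"]
        pow_inG_inM_w_eq_one[OF g h exp[OF g]] g h by simp
    then show "inM (w g h) [^]\<^bsub>?S\<^esub> ?e = \<one>\<^bsub>?S\<^esub>"
      using exp g h by (simp flip: inG.hom_nat_pow)
  next
    fix a b assume ab: "a \<in> P 0" "b \<in> P 0" "a [^]\<^bsub>?S\<^esub> ?e = \<one>\<^bsub>?S\<^esub>" "b [^]\<^bsub>?S\<^esub> ?e = \<one>\<^bsub>?S\<^esub>"
    \<comment> \<open>For two elements of the exterior square [b, a, a] has index 2 + 0 + 2 and is
      killed by \<open>q\<close> by depth alone; the Engel condition enters only for wedges.\<close>
    have "S.cm b a \<in> P 2" using cm_P[OF ab(2,1)] by (simp add: numeral_2_eq_2)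
    from cm_P[OF this ab(1)] have "S.cm (S.cm b a) a \<in> P 3"
      using P_le[of 3 "2 + 0 + 2"] by auto
    then show "(a \<otimes>\<^bsub>?S\<^esub> b) [^]\<^bsub>?S\<^esub> ?e = \<one>\<^bsub>?S\<^esub>"
      using expand[of a b] u_pow[of b a] P3 ab P_0 by auto
  qed
  then have "inM (m [^]\<^bsub>M\<^esub> ?e) = \<one>\<^bsub>?S\<^esub>" using inM.hom_nat_pow[OF m] by simp
  then show ?thesis by simp
qed

section \<open>Translation to exponents and nilpotency class\<close>

lemma group_exponent_dvd:
  assumes "group H" "n > 0" "\<And>x. x \<in> carrier H \<Longrightarrow> x [^]\<^bsub>H\<^esub> n = \<one>\<^bsub>H\<^esub>"
  shows "group_exponent H dvd n"
proof -
  interpret group H by fact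
  let ?Q = "\<lambda>n::nat. n > 0 \<and> (\<forall>x\<in>carrier H. x [^]\<^bsub>H\<^esub> n = \<one>\<^bsub>H\<^esub>)"
  define e where "e = (LEAST n. ?Q n)"
  have Q: "?Q n" using assms by blast
  have e: "?Q e" unfolding e_def using Q by (rule LeastI)
  have "\<exists>n. ?Q n" using Q ..
  then have exp: "group_exponent H = e" unfolding group_exponent_def e_def by (rule if_P)
  have "x [^]\<^bsub>H\<^esub> (n mod e) = \<one>\<^bsub>H\<^esub>" if x: "x \<in> carrier H" for x
  proof -
    have "x [^]\<^bsub>H\<^esub> n = (x [^]\<^bsub>H\<^esub> e) [^]\<^bsub>H\<^esub> (n div e) \<otimes>\<^bsub>H\<^esub> x [^]\<^bsub>H\<^esub> (n mod e)"
      using x by (simp add: nat_pow_pow nat_pow_mult)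
    then show ?thesis using Q e x by simp
  qed
  then have "n mod e = 0 \<or> e \<le> n mod e"
    unfolding e_def using Least_le[of ?Q "n mod e"] by (auto simp: e_def)
  then have "n mod e = 0" using e mod_less_divisor[of e n] by linarith
  then show ?thesis using exp by (simp add: dvd_eq_mod_eq_0)
qed

lemma group_exponent_annihilates:
  assumes "group_exponent H > 0" "x \<in> carrier H"
  shows "x [^]\<^bsub>H\<^esub> group_exponent H = \<one>\<^bsub>H\<^esub>"
proof -
  let ?Q = "\<lambda>n::nat. n > 0 \<and> (\<forall>x\<in>carrier H. x [^]\<^bsub>H\<^esub> n = \<one>\<^bsub>H\<^esub>)"
  have "\<exists>n. ?Q n" using assms(1) by (auto simp: group_exponent_def split: if_splits)
  then have "?Q (LEAST n. ?Q n)" by (rule LeastI_ex)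
  moreover have "group_exponent H = (LEAST n. ?Q n)"
    using \<open>\<exists>n. ?Q n\<close> unfolding group_exponent_def by (rule if_P)
  ultimately show ?thesis using assms(2) by simp
qed

lemma lower_central_trivial:
  assumes "nilpotent_group G" "nilpotency_class G \<le> c"
  shows "lower_central G c = {\<one>\<^bsub>G\<^esub>}"
proof -
  interpret group G using assms(1) by (simp add: nilpotent_group_def)
  have "\<exists>c. lower_central G c = {\<one>\<^bsub>G\<^esub>}" using assms(1) by (simp add: nilpotent_group_def)
  then have "lower_central G (nilpotency_class G) = {\<one>\<^bsub>G\<^esub>}"
    unfolding nilpotency_class_def by (rule LeastI_ex)
  then show ?thesis
    using lower_central_antimono[OF assms(2)] subgroup.one_closed[OF subgroup_lower_central[of c]] by auto
qed

theorem theorem2p5: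
  fixes G :: "('a, 'm) monoid_scheme"
  assumes "group G"
    and "finite (carrier G)"
    and "\<exists>n::nat. order G = 3 ^ n"
    and "nilpotent_group G"
    and "nilpotency_class G \<le> 5"
  shows "group_exponent (exterior_square G) dvd group_exponent G"
proof -
  interpret group G by fact
  obtain n :: nat where n: "order G = 3 ^ n" using assms(3) by blast
  have "group_exponent G dvd 3 ^ n"
    using pow_order_eq_1 n by (intro group_exponent_dvd assms(1)) auto
  then obtain k where k: "group_exponent G = 3 ^ k"
    using divides_primepow_nat[of 3 "group_exponent G" n] by auto
  have exp: "x [^]\<^bsub>G\<^esub> group_exponent G = \<one>\<^bsub>G\<^esub>" if "x \<in> carrier G" for x
    using that k by (intro group_exponent_annihilates) auto
  obtain w act d where "exterior_pairing G (exterior_square G) w act d"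
    using exterior_pairing_exterior_square[OF assms(1)] by blast
  then interpret E: exterior_pairing G "exterior_square G" w act d .
  have "m [^]\<^bsub>exterior_square G\<^esub> group_exponent G = \<one>\<^bsub>exterior_square G\<^esub>"
    if m: "m \<in> carrier (exterior_square G)" for m
  proof (cases k)
    case 0
    then have "carrier G = {\<one>\<^bsub>G\<^esub>}" using exp k by auto
    then have "{w g h | g h. g \<in> carrier G \<and> h \<in> carrier G} \<subseteq> {\<one>\<^bsub>exterior_square G\<^esub>}" by auto
    then have "carrier (exterior_square G) \<subseteq> {\<one>\<^bsub>exterior_square G\<^esub>}"
      unfolding E.generated by (rule E.M.generate_subgroup_incl[OF _ E.M.triv_subgroup])
    then show ?thesis using m by auto
  next
    case (Suc j)
    then show ?thesis
      using E.three_group_exponent[OF lower_central_trivial[OF assms(4,5)] HOL.refl _ m, of j] exp k by simp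
  qed
  then show ?thesis
    using k by (intro group_exponent_dvd E.M.group_axioms) auto
qed

end
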